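(* Let $u$ be the potential density of a transient Markov process in $\mathbb{R}^1$ and assume that $u(s,s)$ is constant for all $|s|\le\epsilon$, for some $\epsilon>0$. Set $$\sigma_{s,t}^2=2u(0,0)-u(s,t)-u(t,s)$$ and assume that, for some constant $C<1$, $$|u(s,t)-u(t,s)|\le C\,\sigma_{s,t}^2$$ for all $|s|,|t|\le\epsilon$. For $t_1,\dots,t_n$ let $(\sigma_n^* )^2(t_1,\dots,t_n)=\inf_{1\le i,j\le n,\ i\ne j}\sigma^2_{t_i,t_j}$. Then $$\limsup_{n\to\infty}\left(\sup_{(t_1,\dots,t_n):\ |t_i|\le\epsilon\ \forall i}(\sigma_n^* )^2(t_1,\dots,t_n)\right)\log n=\infty$$ implies that the $\alpha$-permanental process with kernel $u$ is unbounded almost surely, for every $\alpha>0$.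
   Context: For $\alpha>0$, the $\alpha$-permanental process with kernel $\{u(s,t),s,t\in T\}$ is the non-negative stochastic process $\{X_t,t\in T\}$ such that for all $t_1,\dots,t_n\in T$ and $s_1,\dots,s_n\ge 0$, $E\left(e^{-\sum_i s_iX_{t_i}}\right)=|I+KS|^{-\alpha}$ with $K=\{u(t_i,t_j)\}_{i,j=1}^n$, $S=\mathrm{diag}(s_1,\dots,s_n)$ and $|\cdot|$ the determinant. Here $T=\mathbb{R}^1$ is the state space of the Markov process; the transient Markov process is taken to have local times $L^y_t$ normalized so that its ($0$-)potential density is $u(x,y)=E^x(L^y_\infty)<\infty$. It is a known fact that for such $u$ an $\alpha$-permanental process with kernel $u$ exists for every $\alpha>0$, and that for distinct $t_1,\dots,t_n$ the matrix $\{u(t_i,t_j)\}_{i,j=1}^n$ is invertible and its inverse is a nonsingular $M$-matrix (off-diagonal entries $\le 0$, inverse entrywise $\ge 0$) with row sums $\ge0$. "Unbounded almost surely" means $\sup_t X_t=\infty$ almost surely (the event contains a measurable event of probability one). *)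

theory Defs
  imports
    "HOL-Probability.Probability"
    "Jordan_Normal_Form.Determinant"
begin

text \<open>
  A right-continuous strong Markov process with values in the real line and possibly finite
  lifetime.  Encoding:

  \<^item> Times range over \<open>[0, \<infinity>]\<close>, that is over \<^typ>\<open>ennreal\<close>, so that stopping times may be infinite;
    \<open>F \<infinity>\<close> is the ambient \<open>\<sigma>\<close>-algebra.
  \<^item> The cemetery is the value \<open>\<infinity>\<close> of \<^typ>\<open>ereal\<close>; the value \<open>-\<infinity>\<close> is never taken.  By the usual
    convention the process is in the cemetery at time \<open>\<infinity>\<close>, so \<open>X (T \<omega>) \<omega> \<noteq> \<infinity>\<close> entails
    \<open>T \<omega> < \<infinity>\<close>.
  \<^item> \<open>P x\<close> is the law of the process started at \<open>x\<close>, and \<open>\<theta> t\<close> is the shift by \<open>t\<close>.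

  The assumption \<open>strong_Markov\<close> says \<open>E\<^sup>x(Z \<circ> \<theta>\<^sub>T | F\<^sub>T) = E\<^bsup>X\<^sub>T\<^esup>(Z)\<close> on \<open>{X\<^sub>T \<noteq> \<infinity>}\<close>.  The
  two measurability assumptions before it ensure that both of its integrands are measurable.  They
  do not force \<open>x \<mapsto> E\<^sup>x(Z)\<close> to be Borel, so that the filtration may be an augmented one, for which
  this function is in general only universally measurable.
\<close>

locale markov_process = filtration \<Omega> F
  for \<Omega> :: "'a set" and F :: "ennreal \<Rightarrow> 'a measure" +
  fixes P :: "real \<Rightarrow> 'a measure"
    and X :: "ennreal \<Rightarrow> 'a \<Rightarrow> ereal"
    and \<theta> :: "ennreal \<Rightarrow> 'a \<Rightarrow> 'a"
  assumes filtration_right_continuous: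
      "t < \<infinity> \<Longrightarrow> sets (F t) = (\<Inter>s\<in>{t<..}. sets (F s))"
    and prob_space_P: "prob_space (P x)"
    and sets_P: "sets (P x) = sets (F \<infinity>)"
    and adapted: "X t \<in> borel_measurable (F t)"
    and not_minus_infinity: "\<omega> \<in> \<Omega> \<Longrightarrow> X t \<omega> \<noteq> -\<infinity>"
    and right_continuous: "\<omega> \<in> \<Omega> \<Longrightarrow> continuous (at_right t) (\<lambda>s. X s \<omega>)"
    and cemetery_absorbing: "\<omega> \<in> \<Omega> \<Longrightarrow> X s \<omega> = \<infinity> \<Longrightarrow> s \<le> t \<Longrightarrow> X t \<omega> = \<infinity>"
    and cemetery_at_infinity: "\<omega> \<in> \<Omega> \<Longrightarrow> X \<infinity> \<omega> = \<infinity>"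
    and start: "AE \<omega> in P x. X 0 \<omega> = ereal x"
    and transition_measurable:
      "A \<in> sets borel \<Longrightarrow>
        (\<lambda>x. emeasure (P x) {\<omega>\<in>\<Omega>. X t \<omega> \<in> ereal ` A}) \<in> borel_measurable borel"
    and shift_closed: "\<omega> \<in> \<Omega> \<Longrightarrow> t < \<infinity> \<Longrightarrow> \<theta> t \<omega> \<in> \<Omega>"
    and shift: "\<omega> \<in> \<Omega> \<Longrightarrow> t < \<infinity> \<Longrightarrow> X s (\<theta> t \<omega>) = X (t + s) \<omega>"
    and shift_measurable:
      "\<And>T (Z :: 'a \<Rightarrow> ennreal). stopping_time F T \<Longrightarrow> Z \<in> borel_measurable (F \<infinity>) \<Longrightarrow>
        (\<lambda>\<omega>. if X (T \<omega>) \<omega> = \<infinity> then 0 else Z (\<theta> (T \<omega>) \<omega>)) \<in> borel_measurable (F \<infinity>)"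
    and kernel_measurable:
      "\<And>T (Z :: 'a \<Rightarrow> ennreal). stopping_time F T \<Longrightarrow> Z \<in> borel_measurable (F \<infinity>) \<Longrightarrow>
        (\<lambda>\<omega>. if X (T \<omega>) \<omega> = \<infinity> then 0 else \<integral>\<^sup>+ \<omega>'. Z \<omega>' \<partial>P (real_of_ereal (X (T \<omega>) \<omega>)))
          \<in> borel_measurable (pre_sigma T)"
    and strong_Markov:
      "\<And>T (Z :: 'a \<Rightarrow> ennreal) G x.
        stopping_time F T \<Longrightarrow> Z \<in> borel_measurable (F \<infinity>) \<Longrightarrow> G \<in> sets (pre_sigma T) \<Longrightarrow>
        (\<integral>\<^sup>+ \<omega>\<in>{\<omega>\<in>G. X (T \<omega>) \<omega> \<noteq> \<infinity>}. Z (\<theta> (T \<omega>) \<omega>) \<partial>P x) =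
        (\<integral>\<^sup>+ \<omega>\<in>{\<omega>\<in>G. X (T \<omega>) \<omega> \<noteq> \<infinity>}.
            (\<integral>\<^sup>+ \<omega>'. Z \<omega>' \<partial>P (real_of_ereal (X (T \<omega>) \<omega>))) \<partial>P x)"
begin

text \<open>
  Continuity is required on all of \<open>[0, \<infinity>]\<close>, so \<open>A \<infinity> \<omega>\<close> is the limit of \<open>A t \<omega>\<close> as \<open>t\<close> tends
  to \<open>\<infinity>\<close>.  The last clause says that \<open>A\<close> does not increase after the lifetime.
\<close>

definition continuous_additive_functional :: "(ennreal \<Rightarrow> 'a \<Rightarrow> ennreal) \<Rightarrow> bool" where
  "continuous_additive_functional A \<longleftrightarrow>
    (\<forall>t. A t \<in> borel_measurable (F t)) \<and>
    (\<forall>x. AE \<omega> in P x.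
      A 0 \<omega> = 0 \<and> mono (\<lambda>t. A t \<omega>) \<and> continuous_on UNIV (\<lambda>t. A t \<omega>) \<and>
      (\<forall>t s. t < \<infinity> \<longrightarrow> A (t + s) \<omega> = A t \<omega> + A s (\<theta> t \<omega>)) \<and>
      (\<forall>t s. X t \<omega> = \<infinity> \<longrightarrow> t \<le> s \<longrightarrow> A s \<omega> = A t \<omega>))"

definition first_increase :: "(ennreal \<Rightarrow> 'a \<Rightarrow> ennreal) \<Rightarrow> 'a \<Rightarrow> ennreal" where
  "first_increase A \<omega> = Inf {t. 0 < A t \<omega>}"

definition local_time_at :: "real \<Rightarrow> (ennreal \<Rightarrow> 'a \<Rightarrow> ennreal) \<Rightarrow> bool" where
  "local_time_at y A \<longleftrightarrow>
    continuous_additive_functional A \<and>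
    (AE \<omega> in P y. first_increase A \<omega> = 0) \<and>
    (\<forall>x. x \<noteq> y \<longrightarrow> (AE \<omega> in P x. first_increase A \<omega> \<noteq> 0))"

end

text \<open>
  \<open>u\<close> is the \<open>0\<close>-potential density of the process with respect to \<open>m\<close>, in the version given by the
  total local times, \<open>u x y = E\<^sup>x(L\<^sup>y\<^sub>\<infinity>)\<close>.  Transience is the finiteness of \<open>u\<close>, which is built into
  its type.
\<close>

locale transient_markov_potential = markov_process \<Omega> F P X \<theta>
  for \<Omega> :: "'a set" and F P X \<theta> +
  fixes L :: "real \<Rightarrow> ennreal \<Rightarrow> 'a \<Rightarrow> ennreal"
    and m :: "real measure"
    and u :: "real \<Rightarrow> real \<Rightarrow> real"
  assumes local_times: "local_time_at y (L y)"
    and u_nonneg: "0 \<le> u x y"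
    and u_local_time: "(\<integral>\<^sup>+ \<omega>. L y \<infinity> \<omega> \<partial>P x) = ennreal (u x y)"
    and sigma_finite_m: "sigma_finite_measure m"
    and sets_m: "sets m = sets borel"
    and u_measurable: "u x \<in> borel_measurable borel"
    and u_density:
      "A \<in> sets borel \<Longrightarrow>
        (\<integral>\<^sup>+ t\<in>{0..}. emeasure (P x) {\<omega>\<in>\<Omega>. X (ennreal t) \<omega> \<in> ereal ` A} \<partial>lborel) =
        (\<integral>\<^sup>+ y\<in>A. ennreal (u x y) \<partial>m)"

definition kernel_mat :: "(real \<Rightarrow> real \<Rightarrow> real) \<Rightarrow> nat \<Rightarrow> (nat \<Rightarrow> real) \<Rightarrow> real mat" where
  "kernel_mat u n t = mat n n (\<lambda>(i, j). u (t i) (t j))"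

definition diagonal_mat :: "nat \<Rightarrow> (nat \<Rightarrow> real) \<Rightarrow> real mat" where
  "diagonal_mat n s = mat n n (\<lambda>(i, j). if i = j then s i else 0)"

text \<open>
  For \<open>powr\<close> to be the intended power the determinant has to be positive.  This needs no separate
  assumption: it is \<open>1\<close> for \<open>s = 0\<close>, and it is continuous in \<open>s\<close> and, the expectation being
  positive, never \<open>0\<close>.
\<close>

definition permanental_process ::
    "real \<Rightarrow> (real \<Rightarrow> real \<Rightarrow> real) \<Rightarrow> 'b measure \<Rightarrow> (real \<Rightarrow> 'b \<Rightarrow> real) \<Rightarrow> bool" where
  "permanental_process \<alpha> u M Y \<longleftrightarrow>
    prob_space M \<and>
    (\<forall>t. Y t \<in> borel_measurable M) \<and>
    (\<forall>t. \<forall>\<omega>\<in>space M. 0 \<le> Y t \<omega>) \<and>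
    (\<forall>n t s. (\<forall>i<n. 0 \<le> s i) \<longrightarrow>
      (\<integral>\<omega>. exp (- (\<Sum>i<n. s i * Y (t i) \<omega>)) \<partial>M) =
      Determinant.det (1\<^sub>m n + kernel_mat u n t * diagonal_mat n s) powr (- \<alpha>))"

definition sigma_sq :: "(real \<Rightarrow> real \<Rightarrow> real) \<Rightarrow> real \<Rightarrow> real \<Rightarrow> real" where
  "sigma_sq u s t = 2 * u 0 0 - u s t - u t s"

definition sigma_star_sq :: "(real \<Rightarrow> real \<Rightarrow> real) \<Rightarrow> nat \<Rightarrow> (nat \<Rightarrow> real) \<Rightarrow> ereal" where
  "sigma_star_sq u n t =
    (INF (i, j)\<in>{(i, j). i < n \<and> j < n \<and> i \<noteq> j}. ereal (sigma_sq u (t i) (t j)))"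

end

theory Submission
  imports Defs "HOL-Real_Asymp.Real_Asymp"
begin

text \<open>
  Fix distinct points \<open>t\<^sub>0, \<dots>, t\<^sub>n\<^sub>-\<^sub>1\<close>.  The strong Markov property at the first time that the local time
  at a point other than \<open>t\<^sub>i\<close> increases gives
  \<open>u(t\<^sub>i, t\<^sub>j) = \<delta>\<^sub>i\<^sub>j l\<^sub>i + \<Sum>\<^sub>k w\<^sub>i\<^sub>k u(t\<^sub>k, t\<^sub>j)\<close> with \<open>l\<^sub>i > 0\<close> and a substochastic matrix \<open>w\<close> with
  zero diagonal.  Hence \<open>|I + KS|\<^sup>-\<^sup>\<alpha>\<close> equals \<open>\<Prod>\<^sub>i (1 + l\<^sub>i s\<^sub>i)\<^sup>-\<^sup>\<alpha>\<close> times
  \<open>|I - w|\<^sup>\<alpha> |I - Zw|\<^sup>-\<^sup>\<alpha>\<close>, where \<open>Z = diag (1 / (1 + l\<^sub>i s\<^sub>i))\<close>.  Gaussian elimination shows that the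
  latter is a power series in the entries of \<open>Z\<close> with nonnegative coefficients.  So the permanental
  vector is a mixture of vectors of independent gamma variables with shapes \<open>\<ge> \<alpha>\<close> and scales \<open>l\<^sub>i\<close>,
  and its maximum is stochastically at least that of independent gamma variables with shape \<open>\<alpha>\<close>
  and scales \<open>l\<^sub>i\<close>, which is of order \<open>(min\<^sub>i l\<^sub>i) log n\<close>.

  The hypothesis on \<open>u(s,t) - u(t,s)\<close> gives \<open>u(0,0) - u(t\<^sub>k, t\<^sub>i) \<ge> (1 - C) \<sigma>\<^sup>2 / 2\<close> with
  \<open>\<sigma>\<^sup>2 = (\<sigma>\<^sup>*)\<^sup>2(t\<^sub>0, \<dots>, t\<^sub>n\<^sub>-\<^sub>1)\<close>, and then the displayed identity for \<open>j = i\<close> gives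
  \<open>l\<^sub>i \<ge> (1 - C) \<sigma>\<^sup>2 / 2\<close>.
\<close>

section \<open>Gamma integrals\<close>

definition gamma_weight :: "real \<Rightarrow> real \<Rightarrow> real" where
  "gamma_weight \<beta> x = indicator {0..} x * x powr (\<beta> - 1) * exp (- x)"

lemma gamma_weight_nonneg: "0 \<le> gamma_weight \<beta> x"
  by (simp add: gamma_weight_def)

lemma has_bochner_integral_gamma_weight:
  assumes "0 < \<beta>"
  shows "has_bochner_integral lborel (gamma_weight \<beta>) (Gamma \<beta>)"
proof (rule has_bochner_integral_nn_integral)
  show "gamma_weight \<beta> \<in> borel_measurable lborel"
    unfolding gamma_weight_def by measurable
  show "(\<integral>\<^sup>+x. ennreal (gamma_weight \<beta> x) \<partial>lborel) = ennreal (Gamma \<beta>)"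
    using Gamma_conv_nn_integral_real[OF assms]
    by (simp add: gamma_weight_def exp_minus divide_inverse)
qed (use assms in \<open>auto simp: gamma_weight_def Gamma_real_nonneg\<close>)

text \<open>The Laplace transform of the gamma law: rescaling the variable by \<open>1 + r\<close>
  merges \<open>exp (- r * x)\<close> with the factor \<open>exp (- x)\<close> of the
  weight.\<close>

lemma has_bochner_integral_gamma_weight_exp:
  assumes "0 < \<beta>" "0 \<le> r"
  shows "has_bochner_integral lborel (\<lambda>x. gamma_weight \<beta> x * exp (- r * x))
    (Gamma \<beta> * (1 + r) powr (- \<beta>))"
proof -
  have r: "1 + r > 0" using assms by simp
  have "has_bochner_integral lborel (\<lambda>x. gamma_weight \<beta> (0 + (1 + r) * x)) (Gamma \<beta> /\<^sub>R \<bar>1 + r\<bar>)"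
    using has_bochner_integral_gamma_weight[OF assms(1)] r
    by (subst (asm) lborel_has_bochner_integral_real_affine_iff[where c="1 + r" and t=0]) auto
  from has_bochner_integral_mult_right[OF this, of "(1 + r) powr (1 - \<beta>)"]
  have *: "has_bochner_integral lborel (\<lambda>x. (1 + r) powr (1 - \<beta>) * gamma_weight \<beta> ((1 + r) * x))
     ((1 + r) powr (1 - \<beta>) * (Gamma \<beta> / (1 + r)))"
    using r by (simp add: divide_inverse mult.commute)
  have "(1 + r) powr (1 - \<beta>) = (1 + r) * (1 + r) powr (- \<beta>)"
    using r powr_add[of "1 + r" 1 "- \<beta>"] by simp
  then have "(1 + r) powr (1 - \<beta>) * (Gamma \<beta> / (1 + r)) = Gamma \<beta> * (1 + r) powr (- \<beta>)"
    using r by simp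
  moreover have "(1 + r) powr (1 - \<beta>) * gamma_weight \<beta> ((1 + r) * x) =
      gamma_weight \<beta> x * exp (- r * x)" for x
  proof (cases "0 \<le> x")
    case True
    have "(1 + r) powr (1 - \<beta>) * (1 + r) powr (\<beta> - 1) = 1"
      using r by (simp flip: powr_add)
    moreover have "exp (- ((1 + r) * x)) = exp (- x) * exp (- r * x)"
      by (simp add: exp_add[symmetric] algebra_simps)
    moreover have "((1 + r) * x) powr (\<beta> - 1) = (1 + r) powr (\<beta> - 1) * x powr (\<beta> - 1)"
      using True r by (simp add: powr_mult)
    moreover have "0 \<le> (1 + r) * x" using True r by simp
    ultimately show ?thesis
      using True by (simp add: gamma_weight_def)
  next
    case False
    then have "(1 + r) * x < 0" using r by (simp add: mult_less_0_iff)
    then show ?thesis using False by (simp add: gamma_weight_def)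
  qed
  ultimately show ?thesis using * by simp
qed

lemma has_bochner_integral_gamma_weight_poly:
  assumes "0 < \<beta>" "0 \<le> r"
  shows "has_bochner_integral lborel (\<lambda>x. gamma_weight \<beta> x * (\<Sum>m\<le>N. a m * exp (- r * x) ^ m))
    (Gamma \<beta> * (\<Sum>m\<le>N. a m * (1 + r * real m) powr (- \<beta>)))"
proof -
  have "has_bochner_integral lborel
      (\<lambda>x. \<Sum>m\<le>N. a m * (gamma_weight \<beta> x * exp (- (r * real m) * x)))
      (\<Sum>m\<le>N. a m * (Gamma \<beta> * (1 + r * real m) powr (- \<beta>)))"
    using assms
    by (intro has_bochner_integral_sum has_bochner_integral_mult_right
        has_bochner_integral_gamma_weight_exp) auto
  moreover have "exp (- (r * real m) * x) = exp (- r * x) ^ m" for m x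
    by (simp add: exp_of_nat_mult[symmetric] algebra_simps)
  ultimately show ?thesis
    by (simp add: sum_distrib_left mult.left_commute)
qed

text \<open>Up to the factor \<open>Gamma \<beta>\<close> the sum is the integral of the polynomial
  at \<open>exp (- r * x)\<close>, and this argument lies in the unit interval on the support of the
  weight.\<close>

lemma gamma_poly_nonneg:
  assumes "0 < \<beta>" "0 \<le> r"
    and "\<And>y. 0 \<le> y \<Longrightarrow> y \<le> 1 \<Longrightarrow> 0 \<le> (\<Sum>m\<le>N. a m * y ^ m)"
  shows "0 \<le> (\<Sum>m\<le>N. a m * (1 + r * real m) powr (- \<beta>))"
proof -
  have "0 \<le> Gamma \<beta> * (\<Sum>m\<le>N. a m * (1 + r * real m) powr (- \<beta>))"
    unfolding has_bochner_integral_integral_eq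
      [OF has_bochner_integral_gamma_weight_poly[OF assms(1,2)], symmetric]
  proof (rule Bochner_Integration.integral_nonneg)
    fix x
    show "0 \<le> gamma_weight \<beta> x * (\<Sum>m\<le>N. a m * exp (- r * x) ^ m)"
    proof (cases "0 \<le> x")
      case True
      then show ?thesis
        using assms by (intro mult_nonneg_nonneg gamma_weight_nonneg assms(3)) auto
    qed (simp add: gamma_weight_def)
  qed
  moreover have "0 < Gamma \<beta>" using assms by simp
  ultimately show ?thesis by (simp add: zero_le_mult_iff)
qed

text \<open>The difference of the two sides is, up to the factor \<open>r\<close>, the expression of
  \<open>gamma_poly_nonneg\<close> for \<open>y p'(y)\<close> and \<open>\<beta> + 1\<close>.\<close>

lemma gamma_poly_antimono_Suc:
  assumes "0 < \<beta>" "0 \<le> r"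
    and "\<And>y. 0 \<le> y \<Longrightarrow> y \<le> 1 \<Longrightarrow> 0 \<le> (\<Sum>m\<le>N. real m * a m * y ^ m)"
  shows "(\<Sum>m\<le>N. a m * (1 + r * real m) powr (- (\<beta> + 1))) \<le>
    (\<Sum>m\<le>N. a m * (1 + r * real m) powr (- \<beta>))"
proof -
  have "0 \<le> r * (\<Sum>m\<le>N. real m * a m * (1 + r * real m) powr (- (\<beta> + 1)))"
    using assms by (intro mult_nonneg_nonneg gamma_poly_nonneg) auto
  also have "\<dots> = (\<Sum>m\<le>N. a m * (1 + r * real m) powr (- \<beta>)) -
      (\<Sum>m\<le>N. a m * (1 + r * real m) powr (- (\<beta> + 1)))"
    unfolding sum_distrib_left sum_subtractf[symmetric]
  proof (rule sum.cong[OF refl])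
    fix m
    have p: "1 + r * real m > 0" using assms by (simp add: add_pos_nonneg)
    have "(1 + r * real m) powr (- \<beta>) = (1 + r * real m) powr (- (\<beta> + 1)) * (1 + r * real m)"
      using p powr_add[of "1 + r * real m" "- (\<beta> + 1)" 1] by simp
    then show "r * (real m * a m * (1 + r * real m) powr (- (\<beta> + 1))) =
        a m * (1 + r * real m) powr (- \<beta>) - a m * (1 + r * real m) powr (- (\<beta> + 1))"
      by (simp add: algebra_simps)
  qed
  finally show ?thesis by simp
qed

text \<open>A larger shape means a stochastically larger gamma variable, hence a smaller
  \<open>exp (- r * x)\<close>, at which the polynomial, increasing on the unit interval, is
  smaller. The increments are integers because the exponents in \<open>gamma_mixtures\<close>
  are.\<close>

lemma gamma_poly_antimono:
  assumes "0 < \<beta>" "0 \<le> r"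
    and "\<And>y. 0 \<le> y \<Longrightarrow> y \<le> 1 \<Longrightarrow> 0 \<le> (\<Sum>m\<le>N. real m * a m * y ^ m)"
  shows "(\<Sum>m\<le>N. a m * (1 + r * real m) powr (- (\<beta> + real k))) \<le>
    (\<Sum>m\<le>N. a m * (1 + r * real m) powr (- \<beta>))"
proof (induction k)
  case (Suc k)
  have "(\<Sum>m\<le>N. a m * (1 + r * real m) powr (- ((\<beta> + real k) + 1))) \<le>
    (\<Sum>m\<le>N. a m * (1 + r * real m) powr (- (\<beta> + real k)))"
    using assms by (intro gamma_poly_antimono_Suc) auto
  with Suc show ?case by (simp add: algebra_simps)
qed simp

section \<open>Polynomials that approximate an indicator function\<close>

definition cutoff_coeff :: "nat \<Rightarrow> nat \<Rightarrow> real" where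
  "cutoff_coeff N m = (if m = 0 then 1 else 0) - real (N choose m) * (- 1) ^ m"

lemma sum_signed_binomial: "(\<Sum>m\<le>N. real (N choose m) * (- 1) ^ m * y ^ m) = (1 - y) ^ N"
proof -
  have "(- y) ^ m = (- 1) ^ m * y ^ m" for m
    by (rule power_minus)
  then show ?thesis
    using binomial_ring[of "- y" 1 N] by (simp add: mult.assoc)
qed

text \<open>For \<open>N > 0\<close> this polynomial increases from 0 to 1 on the unit interval, and
  for large \<open>N\<close> it is close to 1 away from 0. At
  \<open>y = exp (- \<theta> * x)\<close> it stands in for the indicator of an upper bound on
  \<open>x\<close>, and its expectation is a combination of values of the Laplace transform.\<close>

lemma sum_cutoff_coeff: "(\<Sum>m\<le>N. cutoff_coeff N m * y ^ m) = 1 - (1 - y) ^ N"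
proof -
  have "(\<Sum>m\<le>N. (if m = 0 then 1 else 0) * y ^ m) = (\<Sum>m\<le>N. if m = 0 then 1 else 0)"
    by (rule sum.cong) auto
  then show ?thesis
    using sum_signed_binomial[of N y]
    by (simp add: cutoff_coeff_def left_diff_distrib sum_subtractf del: mult_if_delta)
qed

text \<open>The left side is \<open>y\<close> times the derivative of the cutoff polynomial, whose
  sign on the unit interval \<open>gamma_poly_antimono\<close> asks for. The absorption identity
  \<open>Suc_times_binomial\<close> reduces it to \<open>sum_signed_binomial\<close>.\<close>

lemma sum_cutoff_coeff_deriv:
  "(\<Sum>m\<le>Suc N. real m * cutoff_coeff (Suc N) m * y ^ m) = real (Suc N) * y * (1 - y) ^ N"
proof -
  have "(\<Sum>m\<le>Suc N. real m * cutoff_coeff (Suc N) m * y ^ m) =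
      (\<Sum>m\<le>N. real (Suc m) * cutoff_coeff (Suc N) (Suc m) * y ^ Suc m)"
    by (simp only: sum.atMost_Suc_shift of_nat_0 mult_zero_left add_0)
  also have "\<dots> = (\<Sum>m\<le>N. real (Suc N) * y * (real (N choose m) * (- 1) ^ m * y ^ m))"
  proof (rule sum.cong[OF refl])
    fix m
    have "real (Suc m) * real (Suc N choose Suc m) = real (Suc N) * real (N choose m)"
      by (simp only: of_nat_mult[symmetric] Suc_times_binomial)
    moreover have "cutoff_coeff (Suc N) (Suc m) = real (Suc N choose Suc m) * (- 1) ^ m"
      unfolding cutoff_coeff_def by (simp del: binomial_Suc_Suc)
    ultimately have "real (Suc m) * cutoff_coeff (Suc N) (Suc m) =
        real (Suc N) * (real (N choose m) * (- 1) ^ m)"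
      by (simp only: mult.assoc[symmetric])
    then show "real (Suc m) * cutoff_coeff (Suc N) (Suc m) * y ^ Suc m =
        real (Suc N) * y * (real (N choose m) * (- 1) ^ m * y ^ m)"
      by (simp only: power_Suc mult.assoc mult.left_commute)
  qed
  also have "\<dots> = real (Suc N) * y * (1 - y) ^ N"
    by (simp only: sum_distrib_left[symmetric] sum_signed_binomial)
  finally show ?thesis .
qed

text \<open>From \<open>x \<le> exp x\<close>: for \<open>1 \<le> x\<close> the number
  \<open>exp (- x)\<close> is at most \<open>1 / x\<close>, hence at most
  \<open>x powr (\<alpha> - 1)\<close> for every positive \<alpha>. The 2 in the exponent affects
  only constants later on.\<close>

lemma gamma_weight_tail:
  assumes "1 \<le> x" "0 < \<alpha>"
  shows "exp (- 2 * x) \<le> gamma_weight \<alpha> x"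
proof -
  have "exp (- x) \<le> x powr (- 1)"
  proof -
    have "x \<le> exp x" using exp_ge_add_one_self[of x] by linarith
    then have "inverse (exp x) \<le> inverse x" using assms by (intro le_imp_inverse_le) auto
    then show ?thesis using assms powr_minus[of x 1] by (simp only: exp_minus powr_one)
  qed
  also have "\<dots> \<le> x powr (\<alpha> - 1)"
    using assms by (intro powr_mono) auto
  finally have "exp (- x) * exp (- x) \<le> x powr (\<alpha> - 1) * exp (- x)"
    by simp
  moreover have "exp (- 2 * x) = exp (- x) * exp (- x)"
    by (simp only: exp_add[symmetric]) simp
  moreover have "gamma_weight \<alpha> x = x powr (\<alpha> - 1) * exp (- x)"
    using assms by (simp add: gamma_weight_def)
  ultimately show ?thesis by (simp only:)
qed

text \<open>The sum is the expectation of the cutoff polynomial for a gamma variable. The complement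
  \<open>(1 - exp (- r * x)) ^ N\<close> increases in \<open>x\<close>, so beyond \<open>y\<close>
  it is at least its value at \<open>y\<close>, and the tail beyond \<open>y\<close> has mass at
  least \<open>exp (- 2 * y) / (2 * Gamma \<alpha>)\<close>.\<close>

lemma gamma_cutoff_upper:
  assumes "0 < \<alpha>" "0 \<le> r" "1 \<le> y"
  shows "(\<Sum>m\<le>N. cutoff_coeff N m * (1 + r * real m) powr (- \<alpha>)) \<le>
    1 - (1 - exp (- r * y)) ^ N * (exp (- 2 * y) / (2 * Gamma \<alpha>))"
proof -
  define b where "b m = real (N choose m) * (- 1) ^ m" for m
  have G: "0 < Gamma \<alpha>" using assms by simp
  have tail: "has_bochner_integral lborel (\<lambda>x. indicator {y..} x * exp (- 2 * x)) (exp (- 2 * y) / 2)"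
  proof (rule has_bochner_integral_nn_integral)
    have "((\<lambda>x. exp (- 2 * x)) has_integral exp (- 2 * y) / 2) {y..}"
      using has_integral_exp_minus_to_infinity[of 2 y] by simp
    from nn_integral_has_integral_lebesgue[OF _ this]
    show "(\<integral>\<^sup>+x. ennreal (indicator {y..} x * exp (- 2 * x)) \<partial>lborel) = ennreal (exp (- 2 * y) / 2)"
      by simp
  qed auto
  note lhs = has_bochner_integral_mult_right[OF tail, where c="(1 - exp (- r * y)) ^ N"]
  note rhs = has_bochner_integral_gamma_weight_poly[OF assms(1,2), of b N]
  have "(1 - exp (- r * y)) ^ N * (exp (- 2 * y) / 2) \<le>
      Gamma \<alpha> * (\<Sum>m\<le>N. b m * (1 + r * real m) powr (- \<alpha>))"
    unfolding has_bochner_integral_integral_eq[OF lhs, symmetric]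
      has_bochner_integral_integral_eq[OF rhs, symmetric]
  proof (rule Bochner_Integration.integral_mono)
    fix x
    show "(1 - exp (- r * y)) ^ N * (indicator {y..} x * exp (- 2 * x)) \<le>
        gamma_weight \<alpha> x * (\<Sum>m\<le>N. b m * exp (- r * x) ^ m)"
    proof (cases "y \<le> x")
      case True
      have 1: "0 \<le> 1 - exp (- r * y)" using assms by simp
      have 2: "1 - exp (- r * y) \<le> 1 - exp (- r * x)"
        using True assms by (simp add: mult_left_mono)
      have "exp (- 2 * x) * (1 - exp (- r * y)) ^ N \<le> gamma_weight \<alpha> x * (1 - exp (- r * x)) ^ N"
        using True assms 1 2
        by (intro mult_mono gamma_weight_tail power_mono gamma_weight_nonneg) auto
      then show ?thesis
        using True unfolding b_def sum_signed_binomial by (simp add: mult.commute)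
    next
      case False
      have "0 \<le> gamma_weight \<alpha> x * (1 - exp (- r * x)) ^ N"
      proof (cases "0 \<le> x")
        case True
        then show ?thesis using assms by (intro mult_nonneg_nonneg gamma_weight_nonneg) auto
      qed (simp add: gamma_weight_def)
      then show ?thesis
        using False unfolding b_def sum_signed_binomial by simp
    qed
  qed (use lhs rhs in \<open>auto simp: has_bochner_integral_iff\<close>)
  then have "(1 - exp (- r * y)) ^ N * (exp (- 2 * y) / (2 * Gamma \<alpha>)) \<le>
      (\<Sum>m\<le>N. b m * (1 + r * real m) powr (- \<alpha>))"
    using G by (simp add: field_simps)
  moreover have "(\<Sum>m\<le>N. (if m = 0 then 1 else 0) * (1 + r * real m) powr (- \<alpha>)) =
      (\<Sum>m\<le>N. if m = 0 then 1 else (0::real))"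
    by (rule sum.cong) auto
  ultimately show ?thesis
    by (simp add: cutoff_coeff_def b_def left_diff_distrib sum_subtractf del: mult_if_delta)
qed

section \<open>Mixtures of gamma laws\<close>

text \<open>Functions of \<open>s\<close> that are nonnegative combinations, possibly infinite, of monomials in the
  factors \<open>1 / (1 + l\<^sub>i s\<^sub>i)\<close>.  Multiplied by \<open>\<Prod>i<n. (1 + l i * s i) powr (- \<alpha>)\<close> they are Laplace
  transforms of mixtures of independent gamma variables.\<close>

inductive_set gamma_mixtures :: "nat \<Rightarrow> (nat \<Rightarrow> real) \<Rightarrow> ((nat \<Rightarrow> real) \<Rightarrow> real) set"
  for n :: nat and l :: "nat \<Rightarrow> real" where
  monom: "0 \<le> c \<Longrightarrow> (\<lambda>s. c * (\<Prod>i<n. (1 / (1 + l i * s i)) ^ k i)) \<in> gamma_mixtures n l"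
| add: "f \<in> gamma_mixtures n l \<Longrightarrow> g \<in> gamma_mixtures n l \<Longrightarrow>
    (\<lambda>s. f s + g s) \<in> gamma_mixtures n l"
| lim: "(\<And>j. f j \<in> gamma_mixtures n l) \<Longrightarrow>
    (\<And>s. (\<forall>i<n. 0 \<le> s i) \<Longrightarrow> (\<lambda>j :: nat. f j s) \<longlonglongrightarrow> g s) \<Longrightarrow> g \<in> gamma_mixtures n l"

text \<open>Every factor \<open>1 / (1 + l i * s i)\<close> lies between 0 and 1 and equals 1 at
  \<open>s = 0\<close>; the bounds survive sums and limits. The value at 0 is the total mass of the
  mixture.\<close>

lemma gamma_mixtures_bounds:
  assumes "f \<in> gamma_mixtures n l" "\<And>i. i < n \<Longrightarrow> 0 \<le> l i" "\<forall>i<n. 0 \<le> s i"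
  shows "0 \<le> f s \<and> f s \<le> f (\<lambda>_. 0)"
  using assms(1)
proof induction
  case (monom c k)
  have "0 \<le> 1 / (1 + l i * s i) \<and> 1 / (1 + l i * s i) \<le> 1" if "i < n" for i
  proof -
    have "0 \<le> l i * s i" using assms(2,3) that by simp
    then show ?thesis by simp
  qed
  then have "0 \<le> (\<Prod>i<n. (1 / (1 + l i * s i)) ^ k i) \<and> (\<Prod>i<n. (1 / (1 + l i * s i)) ^ k i) \<le> 1"
    by (intro conjI prod_nonneg prod_le_1) (auto intro!: power_le_one zero_le_power simp del: divide_le_eq_1_pos)
  then show ?case using monom by (simp add: mult_left_le)
next
  case (lim f g)
  have 0: "\<forall>i<n. 0 \<le> (\<lambda>_::nat. 0::real) i" by simp
  have "0 \<le> g s"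
    by (rule LIMSEQ_le_const[OF lim.hyps(2)[OF assms(3)]]) (use lim.IH in blast)
  moreover have "g s \<le> g (\<lambda>_. 0)"
    by (rule LIMSEQ_le[OF lim.hyps(2)[OF assms(3)] lim.hyps(2)[OF 0]]) (use lim.IH in blast)
  ultimately show ?case by simp
qed auto

lemma gamma_mixtures_const: "0 \<le> c \<Longrightarrow> (\<lambda>_. c) \<in> gamma_mixtures n l"
  using gamma_mixtures.monom[where c=c and k="\<lambda>_. 0"] by simp

text \<open>The rule \<open>lim\<close> constrains its limit only at nonnegative arguments, so a
  constant sequence transfers membership.\<close>

lemma gamma_mixtures_cong:
  assumes "f \<in> gamma_mixtures n l" "\<And>s. \<forall>i<n. 0 \<le> s i \<Longrightarrow> f s = g s"
  shows "g \<in> gamma_mixtures n l"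
  by (rule gamma_mixtures.lim[of "\<lambda>_. f"]) (use assms in auto)

lemma gamma_mixtures_mult:
  assumes "f \<in> gamma_mixtures n l" "g \<in> gamma_mixtures n l"
  shows "(\<lambda>s. f s * g s) \<in> gamma_mixtures n l"
  using assms(1)
proof induction
  case (monom c k)
  show ?case
    using assms(2)
  proof induction
    case (monom d j)
    have "0 \<le> c * d" using monom \<open>0 \<le> c\<close> by simp
    from gamma_mixtures.monom[OF this, where n=n and l=l and k="\<lambda>i. k i + j i"] show ?case
      by (simp add: power_add prod.distrib mult.assoc mult.left_commute)
  next
    case (add f g)
    then show ?case by (simp add: distrib_left gamma_mixtures.add)
  next
    case (lim f g)
    show ?case
      by (rule gamma_mixtures.lim[where f="\<lambda>j s. c * (\<Prod>i<n. (1 / (1 + l i * s i)) ^ k i) * f j s"])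
        (intro lim.IH tendsto_intros lim.hyps(2), assumption?)+
  qed
next
  case (add f g)
  then show ?case by (simp add: distrib_right gamma_mixtures.add)
next
  case (lim f h)
  show ?case
    by (rule gamma_mixtures.lim[where f="\<lambda>j s. f j s * g s"])
      (intro lim.IH tendsto_intros lim.hyps(2), assumption?)+
qed

lemma gamma_mixtures_power:
  "f \<in> gamma_mixtures n l \<Longrightarrow> (\<lambda>s. f s ^ k) \<in> gamma_mixtures n l"
  by (induction k) (auto intro: gamma_mixtures_mult gamma_mixtures_const)

lemma gamma_mixtures_sum:
  "(\<And>k. k \<in> A \<Longrightarrow> f k \<in> gamma_mixtures n l) \<Longrightarrow> (\<lambda>s. \<Sum>k\<in>A. f k s) \<in> gamma_mixtures n l"
  by (induction A rule: infinite_finite_induct)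
    (auto intro: gamma_mixtures.add gamma_mixtures_const)

text \<open>The binomial series of \<open>(1 - x) powr (- \<alpha>)\<close> has the nonnegative
  coefficients \<open>pochhammer \<alpha> k / fact k\<close>. It converges because
  \<open>f s\<close> is nonnegative and bounded by its value at 0, which is below 1.\<close>

lemma gamma_mixtures_one_minus_powr:
  assumes "f \<in> gamma_mixtures n l" "\<And>i. i < n \<Longrightarrow> 0 \<le> l i" "f (\<lambda>_. 0) < 1" "0 < \<alpha>"
  shows "(\<lambda>s. (1 - f s) powr (- \<alpha>)) \<in> gamma_mixtures n l"
proof (rule gamma_mixtures.lim)
  fix j
  show "(\<lambda>s. \<Sum>k<j. (pochhammer \<alpha> k / fact k) * f s ^ k) \<in> gamma_mixtures n l"
    using assms
    by (intro gamma_mixtures_sum gamma_mixtures_mult gamma_mixtures_const gamma_mixtures_power)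
      (auto intro!: divide_nonneg_pos pochhammer_nonneg)
next
  fix s :: "nat \<Rightarrow> real" assume "\<forall>i<n. 0 \<le> s i"
  from gamma_mixtures_bounds[OF assms(1,2) this] have "0 \<le> f s" "f s < 1"
    using assms(3) by simp_all
  then have "(\<lambda>k. ((- \<alpha>) gchoose k) * (- f s) ^ k) sums (1 + - f s) powr (- \<alpha>)"
    by (intro gen_binomial_real) auto
  moreover have "((- \<alpha>) gchoose k) * (- f s) ^ k = (pochhammer \<alpha> k / fact k) * f s ^ k" for k
    by (simp add: gbinomial_pochhammer power_mult_distrib[symmetric])
  ultimately show "(\<lambda>j. \<Sum>k<j. (pochhammer \<alpha> k / fact k) * f s ^ k) \<longlonglongrightarrow> (1 - f s) powr (- \<alpha>)"
    by (simp add: sums_def)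
qed

text \<open>One step of Gaussian elimination: the unit lower triangular matrix \<open>?L\<close>
  clears the first column below the pivot, and what remains is block upper triangular.\<close>

lemma det_mat_Suc_schur:
  fixes a :: "nat \<Rightarrow> nat \<Rightarrow> 'a :: field"
  assumes "a 0 0 \<noteq> 0"
  shows "Determinant.det (mat (Suc n) (Suc n) (\<lambda>(i, j). a i j)) =
    a 0 0 * Determinant.det (mat n n (\<lambda>(i, j). a (Suc i) (Suc j) - a (Suc i) 0 * a 0 (Suc j) / a 0 0))"
    (is "Determinant.det ?A = _ * Determinant.det ?S")
proof -
  define A1 A2 A3 A4 :: "'a mat" where
    "A1 = mat 1 1 (\<lambda>_. a 0 0)" and "A2 = mat 1 n (\<lambda>(i, j). a 0 (Suc j))" and
    "A3 = mat n 1 (\<lambda>(i, j). a (Suc i) 0)" and "A4 = mat n n (\<lambda>(i, j). a (Suc i) (Suc j))"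
  define C where "C = mat n 1 (\<lambda>(i, j). - a (Suc i) 0 / a 0 0)"
  let ?L = "four_block_mat (1\<^sub>m 1) (0\<^sub>m 1 n) C (1\<^sub>m n)"
  have c: "A1 \<in> carrier_mat 1 1" "A2 \<in> carrier_mat 1 n" "A3 \<in> carrier_mat n 1" "A4 \<in> carrier_mat n n"
    "C \<in> carrier_mat n 1" "?S \<in> carrier_mat n n"
    by (auto simp: A1_def A2_def A3_def A4_def C_def)
  have A: "?A = four_block_mat A1 A2 A3 A4"
    by (rule eq_matI) (auto simp: A1_def A2_def A3_def A4_def less_Suc_eq_0_disj)
  have "?L * ?A = four_block_mat (1\<^sub>m 1 * A1 + 0\<^sub>m 1 n * A3) (1\<^sub>m 1 * A2 + 0\<^sub>m 1 n * A4)
      (C * A1 + 1\<^sub>m n * A3) (C * A2 + 1\<^sub>m n * A4)"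
    unfolding A by (rule mult_four_block_mat) (use c in auto)
  also have "1\<^sub>m 1 * A1 + 0\<^sub>m 1 n * A3 = A1" using c by simp
  also have "1\<^sub>m 1 * A2 + 0\<^sub>m 1 n * A4 = A2" using c by simp
  also have "C * A1 + 1\<^sub>m n * A3 = 0\<^sub>m n 1"
    using assms by (intro eq_matI) (auto simp: A1_def A3_def C_def scalar_prod_def)
  also have "C * A2 + 1\<^sub>m n * A4 = ?S"
    by (intro eq_matI) (auto simp: A2_def A4_def C_def scalar_prod_def)
  finally have LA: "?L * ?A = four_block_mat A1 A2 (0\<^sub>m n 1) ?S" .
  have "Determinant.det ?L * Determinant.det ?A = Determinant.det (?L * ?A)"
    using c by (intro det_mult[symmetric, of _ "Suc n"]) auto
  also have "\<dots> = Determinant.det A1 * Determinant.det ?S"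
    unfolding LA using c by (intro det_four_block_mat_lower_left_zero[of _ 1 _ n]) auto
  also have "Determinant.det A1 = a 0 0"
    using det_single[of A1] by (simp add: A1_def)
  also have "Determinant.det ?L = 1"
    using c by (subst det_four_block_mat_upper_right_zero[of _ 1 _ n]) auto
  finally show ?thesis by simp
qed

text \<open>By elimination of the first row and column.  Both the row sum condition and the class of
  entries are preserved by the Schur complement.\<close>

lemma det_one_minus_mixture:
  assumes l: "\<And>i. i < n \<Longrightarrow> 0 \<le> l i" and \<alpha>: "0 < \<alpha>"
    and "\<And>i j. i < N \<Longrightarrow> j < N \<Longrightarrow> M i j \<in> gamma_mixtures n l"
    and "\<And>i. i < N \<Longrightarrow> (\<Sum>j<N. M i j (\<lambda>_. 0)) \<le> 1"
    and "Determinant.det (mat N N (\<lambda>(i, j). (if i = j then 1 else 0) - M i j (\<lambda>_. 0))) \<noteq> 0"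
  shows "(\<lambda>s. Determinant.det (mat N N (\<lambda>(i, j). (if i = j then 1 else 0) - M i j s)) powr (- \<alpha>))
      \<in> gamma_mixtures n l \<and>
    (\<forall>s. (\<forall>i<n. 0 \<le> s i) \<longrightarrow>
      0 < Determinant.det (mat N N (\<lambda>(i, j). (if i = j then 1 else 0) - M i j s)))"
  using assms(3-)
proof (induction N arbitrary: M)
  case 0
  have "Determinant.det (mat 0 0 f) = (1 :: real)" for f
    by (rule det_dim_zero) auto
  then show ?case using gamma_mixtures_const[of 1 n l] by simp
next
  case (Suc N)
  define z where "z = (\<lambda>_ :: nat. 0 :: real)"
  have z: "\<forall>i<n. 0 \<le> z i" by (simp add: z_def)
  note M = Suc.prems(1) and row = Suc.prems(2)[folded z_def] and det = Suc.prems(3)[folded z_def]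
  define a where "a s i j = (if i = j then 1 else 0) - M i j s" for s i j
  \<comment> \<open>\<open>I - M'\<close> is the Schur complement of \<open>I - M\<close>. The
    reciprocal of the pivot is written with \<open>powr\<close> so that
    \<open>gamma_mixtures_one_minus_powr\<close> applies with exponent 1.\<close>
  define M' where "M' i j s = M (Suc i) (Suc j) s + M (Suc i) 0 s * (M 0 (Suc j) s * (1 - M 0 0 s) powr (- 1))" for i j s
  have Mnn: "0 \<le> M i j z" if "i < Suc N" "j < Suc N" for i j
    using gamma_mixtures_bounds[OF M[OF that] l z] by simp
  have row_split: "M i 0 z + (\<Sum>j<N. M i (Suc j) z) \<le> 1" if "i < Suc N" for i
    using row[OF that] by (simp only: sum.lessThan_Suc_shift)
  have sum_nn: "0 \<le> (\<Sum>j<N. M i (Suc j) z)" if "i < Suc N" for i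
    using that by (intro sum_nonneg Mnn) auto
  \<comment> \<open>Otherwise the row sum bound makes the first row of \<open>M\<close> at 0 equal
    to \<open>(1, 0, ..., 0)\<close>, so that \<open>I - M\<close> has a zero row, against the
    determinant hypothesis.\<close>
  have M00: "M 0 0 z < 1"
  proof (rule ccontr)
    assume "\<not> M 0 0 z < 1"
    then have 1: "M 0 0 z = 1" and "(\<Sum>j<N. M 0 (Suc j) z) = 0"
      using row_split[of 0] sum_nn[of 0] by auto
    then have 2: "M 0 (Suc j) z = 0" if "j < N" for j
      using that Mnn by (subst (asm) sum_nonneg_eq_0_iff) auto
    have "Determinant.det (mat (Suc N) (Suc N) (\<lambda>(i, j). (if i = j then 1 else 0) - M i j z)) = 0"
      (is "Determinant.det ?A = 0")
    proof -
      have 3: "?A $$ (0, j) = 0" if "j < Suc N" for j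
        using that 1 2 by (cases j) auto
      have "Determinant.det ?A = (\<Sum>j<Suc N. ?A $$ (0, j) * cofactor ?A 0 j)"
        by (rule laplace_expansion_row) auto
      also have "\<dots> = 0" using 3 by (intro sum.neutral) auto
      finally show ?thesis .
    qed
    then show False using det by simp
  qed
  have M00s: "0 < 1 - M 0 0 s" if "\<forall>i<n. 0 \<le> s i" for s
    using gamma_mixtures_bounds[OF M[of 0 0] l that] M00 by (simp add: z_def)
  have inv: "(1 - M 0 0 s) powr (- 1) = 1 / (1 - M 0 0 s)" if "\<forall>i<n. 0 \<le> s i" for s
    using M00s[OF that] by (simp add: powr_minus divide_inverse)
  have split: "Determinant.det (mat (Suc N) (Suc N) (\<lambda>(i, j). (if i = j then 1 else 0) - M i j s)) =
      (1 - M 0 0 s) * Determinant.det (mat N N (\<lambda>(i, j). (if i = j then 1 else 0) - M' i j s))"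
    if s: "\<forall>i<n. 0 \<le> s i" for s
  proof -
    have "mat N N (\<lambda>(i, j). a s (Suc i) (Suc j) - a s (Suc i) 0 * a s 0 (Suc j) / a s 0 0) =
        mat N N (\<lambda>(i, j). (if i = j then 1 else 0) - M' i j s)"
      unfolding M'_def inv[OF s] by (rule eq_matI) (auto simp: a_def)
    then show ?thesis
      using det_mat_Suc_schur[of "a s" N] M00s[OF s] by (simp add: a_def)
  qed
  have M': "M' i j \<in> gamma_mixtures n l" if "i < N" "j < N" for i j
    unfolding M'_def using that M00
    by (intro gamma_mixtures.add gamma_mixtures_mult gamma_mixtures_one_minus_powr M l)
      (auto simp: z_def)
  \<comment> \<open>By the bound for row 0 the entries right of the pivot, divided by
    \<open>1 - M 0 0 z\<close>, sum to at most 1. As for a Markov chain watched only outside the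
    state 0, detours through 0 create no mass.\<close>
  have row': "(\<Sum>j<N. M' i j (\<lambda>_. 0)) \<le> 1" if i: "i < N" for i
  proof -
    have "(\<Sum>j<N. M' i j z) = (\<Sum>j<N. M (Suc i) (Suc j) z) +
        M (Suc i) 0 z * ((\<Sum>j<N. M 0 (Suc j) z) / (1 - M 0 0 z))"
      unfolding M'_def inv[OF z] sum.distrib by (simp add: sum_distrib_left sum_divide_distrib)
    also have "\<dots> \<le> (\<Sum>j<N. M (Suc i) (Suc j) z) + M (Suc i) 0 z * 1"
      using row_split[of 0] M00 i by (intro add_left_mono mult_left_mono Mnn) (auto simp: divide_simps)
    also have "\<dots> \<le> 1" using row_split[of "Suc i"] i by simp
    finally show ?thesis by (simp add: z_def)
  qed
  have det': "Determinant.det (mat N N (\<lambda>(i, j). (if i = j then 1 else 0) - M' i j (\<lambda>_. 0))) \<noteq> 0"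
    using det split[OF z] by (auto simp: z_def)
  note IH = Suc.IH[OF M' row' det']
  have "(\<lambda>s. (1 - M 0 0 s) powr (- \<alpha>) *
      Determinant.det (mat N N (\<lambda>(i, j). (if i = j then 1 else 0) - M' i j s)) powr (- \<alpha>))
      \<in> gamma_mixtures n l"
    using IH M00 by (intro gamma_mixtures_mult gamma_mixtures_one_minus_powr M l \<alpha>) (auto simp: z_def)
  then have "(\<lambda>s. Determinant.det (mat (Suc N) (Suc N) (\<lambda>(i, j). (if i = j then 1 else 0) - M i j s)) powr (- \<alpha>))
      \<in> gamma_mixtures n l"
    by (rule gamma_mixtures_cong) (use split M00s IH in \<open>auto simp: powr_mult\<close>)
  moreover have "0 < Determinant.det (mat (Suc N) (Suc N) (\<lambda>(i, j). (if i = j then 1 else 0) - M i j s))"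
    if "\<forall>i<n. 0 \<le> s i" for s
    using split[OF that] M00s[OF that] IH that by simp
  ultimately show ?case by blast
qed

text \<open>Applied to a Laplace transform \<open>F\<close>, this is the expectation of
  \<open>\<Prod>i<n. p (exp (- \<theta> * X\<^sub>i))\<close> where \<open>p y = (\<Sum>m\<le>N. c m * y ^ m)\<close>.\<close>

definition laplace_eval ::
  "nat \<Rightarrow> nat \<Rightarrow> (nat \<Rightarrow> real) \<Rightarrow> real \<Rightarrow> ((nat \<Rightarrow> real) \<Rightarrow> real) \<Rightarrow> real" where
  "laplace_eval n N c \<theta> F =
    (\<Sum>m\<in>{..<n} \<rightarrow>\<^sub>E {..N}. (\<Prod>i<n. c (m i)) * F (\<lambda>i. \<theta> * real (m i)))"

lemma laplace_eval_prod:
  "laplace_eval n N c \<theta> (\<lambda>s. \<Prod>i<n. h i (s i)) = (\<Prod>i<n. \<Sum>m\<le>N. c m * h i (\<theta> * real m))"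
  unfolding laplace_eval_def
  by (subst prod_sum_PiE) (simp_all add: prod.distrib)

text \<open>Stochastic comparison with independent gamma variables of shape \<alpha>. A monomial
  raises the shapes to \<open>\<alpha> + k i\<close>, which lowers each factor by
  \<open>gamma_poly_antimono\<close>. Both sides are linear in \<open>f\<close> and,
  \<open>laplace_eval\<close> being a finite sum, pass to pointwise limits.\<close>

lemma laplace_eval_gamma_mixture_le:
  assumes f: "f \<in> gamma_mixtures n l" and l: "\<And>i. i < n \<Longrightarrow> 0 \<le> l i" and \<alpha>: "0 < \<alpha>" and \<theta>: "0 \<le> \<theta>"
    and p: "\<And>y. 0 \<le> y \<Longrightarrow> y \<le> 1 \<Longrightarrow> 0 \<le> (\<Sum>m\<le>N. c m * y ^ m)"
    and p': "\<And>y. 0 \<le> y \<Longrightarrow> y \<le> 1 \<Longrightarrow> 0 \<le> (\<Sum>m\<le>N. real m * c m * y ^ m)"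
  shows "laplace_eval n N c \<theta> (\<lambda>s. (\<Prod>i<n. (1 + l i * s i) powr (- \<alpha>)) * f s) \<le>
    f (\<lambda>_. 0) * (\<Prod>i<n. \<Sum>m\<le>N. c m * (1 + l i * \<theta> * real m) powr (- \<alpha>))"
  using f
proof induction
  case (monom d k)
  let ?z = "\<lambda>s. \<Prod>i<n. (1 + l i * s i) powr (- \<alpha>)"
  have "laplace_eval n N c \<theta> (\<lambda>s. ?z s * (d * (\<Prod>i<n. (1 / (1 + l i * s i)) ^ k i))) =
      d * laplace_eval n N c \<theta> (\<lambda>s. \<Prod>i<n. (1 + l i * s i) powr (- \<alpha>) * (1 / (1 + l i * s i)) ^ k i)"
    unfolding laplace_eval_def sum_distrib_left by (simp add: prod.distrib mult_ac)
  also have "\<dots> = d * (\<Prod>i<n. \<Sum>m\<le>N. c m * ((1 + l i * (\<theta> * real m)) powr (- \<alpha>) *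
      (1 / (1 + l i * (\<theta> * real m))) ^ k i))"
    by (subst laplace_eval_prod) simp
  also have "\<dots> = d * (\<Prod>i<n. \<Sum>m\<le>N. c m * (1 + l i * \<theta> * real m) powr (- (\<alpha> + real (k i))))"
  proof (intro arg_cong[where f="(*) d"] prod.cong sum.cong refl)
    fix i m assume "i \<in> {..<n}"
    then have pos: "0 < 1 + l i * \<theta> * real m" using l \<theta> by (simp add: add_pos_nonneg)
    have "(1 + l i * \<theta> * real m) powr (- (\<alpha> + real (k i))) =
        (1 + l i * \<theta> * real m) powr (- \<alpha>) * (1 + l i * \<theta> * real m) powr (- real (k i))"
      by (simp add: powr_add[symmetric])
    also have "(1 + l i * \<theta> * real m) powr (- real (k i)) = (1 / (1 + l i * \<theta> * real m)) ^ k i"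
      using pos by (simp add: powr_minus powr_realpow power_one_over divide_inverse power_inverse)
    finally show "c m * ((1 + l i * (\<theta> * real m)) powr (- \<alpha>) * (1 / (1 + l i * (\<theta> * real m))) ^ k i) =
        c m * (1 + l i * \<theta> * real m) powr (- (\<alpha> + real (k i)))"
      by (simp add: mult.assoc)
  qed
  also have "\<dots> \<le> d * (\<Prod>i<n. \<Sum>m\<le>N. c m * (1 + l i * \<theta> * real m) powr (- \<alpha>))"
    using monom l \<alpha> \<theta> p p'
    by (intro mult_left_mono prod_mono conjI gamma_poly_nonneg gamma_poly_antimono) auto
  finally show ?case by simp
next
  case (add f g)
  let ?z = "\<lambda>s. \<Prod>i<n. (1 + l i * s i) powr (- \<alpha>)"
  have "laplace_eval n N c \<theta> (\<lambda>s. ?z s * (f s + g s)) =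
      laplace_eval n N c \<theta> (\<lambda>s. ?z s * f s) + laplace_eval n N c \<theta> (\<lambda>s. ?z s * g s)"
    by (simp add: laplace_eval_def distrib_left sum.distrib)
  then show ?case using add by (simp add: distrib_right)
next
  case (lim f g)
  have zero: "\<forall>i<n. 0 \<le> (\<lambda>_ :: nat. 0 :: real) i" by simp
  have nn: "\<forall>i<n. 0 \<le> \<theta> * real (m i)" for m :: "nat \<Rightarrow> nat" using \<theta> by simp
  show ?case
  proof (rule LIMSEQ_le[OF _ tendsto_mult_right[OF lim.hyps(2)[OF zero]]])
    show "(\<lambda>j. laplace_eval n N c \<theta> (\<lambda>s. (\<Prod>i<n. (1 + l i * s i) powr (- \<alpha>)) * f j s))
        \<longlonglongrightarrow> laplace_eval n N c \<theta> (\<lambda>s. (\<Prod>i<n. (1 + l i * s i) powr (- \<alpha>)) * g s)"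
      unfolding laplace_eval_def by (intro tendsto_sum tendsto_mult tendsto_const lim.hyps(2) nn)
  qed (use lim.IH in auto)
qed

section \<open>Decomposition of the potential\<close>

text \<open>A countable set of times that replaces the continuum in infima and intersections, which
  keeps events measurable.\<close>

lemma ennreal_countable_dense:
  obtains D :: "ennreal set" where "countable D" "\<And>a b. a < b \<Longrightarrow> \<exists>d\<in>D. a < d \<and> d < b"
proof -
  obtain D :: "ennreal set" where D: "countable D"
    "\<And>X. open X \<Longrightarrow> X \<noteq> {} \<Longrightarrow> \<exists>d\<in>D. d \<in> X"
    using countable_dense_exists by blast
  have "\<exists>d\<in>D. a < d \<and> d < b" if ab: "a < b" for a b
  proof -
    obtain c where "a < c" "c < b" using dense[OF ab] by blast
    then have "{a<..<b} \<noteq> {}" by auto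
    from D(2)[OF open_greaterThanLessThan this] show ?thesis by auto
  qed
  with D(1) show ?thesis by (rule that)
qed

section \<open>Additive functionals and stopping times\<close>

context markov_process
begin

lemma space_P: "space (P x) = \<Omega>"
  using sets_eq_imp_space_eq[OF sets_P] space_F by simp

lemma measurable_P: "measurable (P x) N = measurable (F \<infinity>) N"
  by (rule measurable_cong_sets[OF sets_P refl])

lemma measurable_F_mono: "f \<in> measurable (F s) N \<Longrightarrow> s \<le> t \<Longrightarrow> f \<in> measurable (F t) N"
  using sets_F_mono[of s t] by (auto simp: measurable_def space_F)

lemma continuous_additive_functional_measurable:
  "continuous_additive_functional A \<Longrightarrow> A t \<in> borel_measurable (F t)"
  by (simp add: continuous_additive_functional_def)

lemma continuous_additive_functional_AE:
  "continuous_additive_functional A \<Longrightarrow> AE \<omega> in P x.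
    A 0 \<omega> = 0 \<and> mono (\<lambda>t. A t \<omega>) \<and> continuous_on UNIV (\<lambda>t. A t \<omega>) \<and>
    (\<forall>t s. t < \<infinity> \<longrightarrow> A (t + s) \<omega> = A t \<omega> + A s (\<theta> t \<omega>)) \<and>
    (\<forall>t s. X t \<omega> = \<infinity> \<longrightarrow> t \<le> s \<longrightarrow> A s \<omega> = A t \<omega>)"
  by (simp add: continuous_additive_functional_def)

lemma continuous_additive_functional_sum:
  assumes "finite J" "\<And>y. y \<in> J \<Longrightarrow> continuous_additive_functional (A y)"
  shows "continuous_additive_functional (\<lambda>t \<omega>. \<Sum>y\<in>J. A y t \<omega>)"
  unfolding continuous_additive_functional_def
proof (intro conjI allI)
  fix t
  show "(\<lambda>\<omega>. \<Sum>y\<in>J. A y t \<omega>) \<in> borel_measurable (F t)"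
    using assms(2) by (intro borel_measurable_sum continuous_additive_functional_measurable)
next
  fix x
  have "AE \<omega> in P x. \<forall>y\<in>J. A y 0 \<omega> = 0 \<and> mono (\<lambda>t. A y t \<omega>) \<and> continuous_on UNIV (\<lambda>t. A y t \<omega>) \<and>
    (\<forall>t s. t < \<infinity> \<longrightarrow> A y (t + s) \<omega> = A y t \<omega> + A y s (\<theta> t \<omega>)) \<and>
    (\<forall>t s. X t \<omega> = \<infinity> \<longrightarrow> t \<le> s \<longrightarrow> A y s \<omega> = A y t \<omega>)"
    using assms by (intro AE_finite_allI continuous_additive_functional_AE)
  then show "AE \<omega> in P x. (\<Sum>y\<in>J. A y 0 \<omega>) = 0 \<and> mono (\<lambda>t. \<Sum>y\<in>J. A y t \<omega>) \<and>
      continuous_on UNIV (\<lambda>t. \<Sum>y\<in>J. A y t \<omega>) \<and>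
      (\<forall>t s. t < \<infinity> \<longrightarrow> (\<Sum>y\<in>J. A y (t + s) \<omega>) = (\<Sum>y\<in>J. A y t \<omega>) + (\<Sum>y\<in>J. A y s (\<theta> t \<omega>))) \<and>
      (\<forall>t s. X t \<omega> = \<infinity> \<longrightarrow> t \<le> s \<longrightarrow> (\<Sum>y\<in>J. A y s \<omega>) = (\<Sum>y\<in>J. A y t \<omega>))"
  proof eventually_elim
    case (elim \<omega>)
    show ?case
    proof (intro conjI allI impI)
      show "mono (\<lambda>t. \<Sum>y\<in>J. A y t \<omega>)"
        using elim by (intro monoI sum_mono) (blast dest: monoD)
      show "continuous_on UNIV (\<lambda>t. \<Sum>y\<in>J. A y t \<omega>)"
        using elim by (intro continuous_on_sum) blast
      show "(\<Sum>y\<in>J. A y (t + s) \<omega>) = (\<Sum>y\<in>J. A y t \<omega>) + (\<Sum>y\<in>J. A y s (\<theta> t \<omega>))"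
        if "t < \<infinity>" for t s
        unfolding sum.distrib[symmetric] using elim that by (intro sum.cong) blast+
      show "(\<Sum>y\<in>J. A y s \<omega>) = (\<Sum>y\<in>J. A y t \<omega>)" if "X t \<omega> = \<infinity>" "t \<le> s" for t s
        using elim that by (intro sum.cong) blast+
      show "(\<Sum>y\<in>J. A y 0 \<omega>) = 0" using elim by (intro sum.neutral) blast
    qed
  qed
qed

text \<open>For \<open>t < s\<close> the event \<open>T \<omega> \<le> t\<close> is the intersection
  of the events \<open>T \<omega> < d\<close> over countably many \<open>d\<close> between
  \<open>t\<close> and \<open>s\<close>. So it lies in every \<open>F s\<close> with
  \<open>s > t\<close>, hence in \<open>F t\<close> by right-continuity. At
  \<open>t = \<infinity>\<close> there is no such \<open>s\<close>, but the event is
  everything.\<close>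

lemma stopping_timeI_less:
  assumes "\<And>t. {\<omega>\<in>\<Omega>. T \<omega> < t} \<in> sets (F t)"
  shows "stopping_time F T"
proof
  fix t :: ennreal
  have "{\<omega>\<in>\<Omega>. T \<omega> \<le> t} \<in> sets (F t)"
  proof (cases "t = \<infinity>")
    case True
    then show ?thesis using sets.top[of "F t"] by (simp add: space_F)
  next
    case False
    then have t: "t < \<infinity>" by (simp add: less_top)
    obtain D :: "ennreal set" where D: "countable D" "\<And>a b. a < b \<Longrightarrow> \<exists>d\<in>D. a < d \<and> d < b"
      using ennreal_countable_dense by blast
    have "{\<omega>\<in>\<Omega>. T \<omega> \<le> t} \<in> sets (F s)" if "t < s" for s
    proof -
      have "(\<Inter>d\<in>D \<inter> {t<..<s}. {\<omega>\<in>\<Omega>. T \<omega> < d}) \<in> sets (F s)"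
      proof (rule sets.countable_INT')
        show "countable (D \<inter> {t<..<s})" using D by blast
        show "D \<inter> {t<..<s} \<noteq> {}" using D(2)[OF that] by auto
        show "(\<lambda>d. {\<omega>\<in>\<Omega>. T \<omega> < d}) ` (D \<inter> {t<..<s}) \<subseteq> sets (F s)"
        proof safe
          fix d assume "d \<in> {t<..<s}"
          then have "sets (F d) \<subseteq> sets (F s)" by (intro sets_F_mono) auto
          then show "{\<omega>\<in>\<Omega>. T \<omega> < d} \<in> sets (F s)"
            using assms[of d] by blast
        qed
      qed
      also have "(\<Inter>d\<in>D \<inter> {t<..<s}. {\<omega>\<in>\<Omega>. T \<omega> < d}) = {\<omega>\<in>\<Omega>. T \<omega> \<le> t}"
      proof (intro equalityI subsetI)
        fix \<omega> assume \<omega>: "\<omega> \<in> (\<Inter>d\<in>D \<inter> {t<..<s}. {\<omega>\<in>\<Omega>. T \<omega> < d})"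
        obtain d where "d \<in> D" "t < d" "d < s" using D(2) \<open>t < s\<close> by blast
        then have "\<omega> \<in> \<Omega>" using \<omega> by auto
        moreover have "T \<omega> \<le> t"
        proof (rule ccontr)
          assume "\<not> T \<omega> \<le> t"
          then have "t < min (T \<omega>) s" using that by simp
          then obtain e where e: "e \<in> D" "t < e" "e < min (T \<omega>) s" using D(2) by blast
          then have "T \<omega> < e" using \<omega> by simp
          then show False using e by auto
        qed
        ultimately show "\<omega> \<in> {\<omega>\<in>\<Omega>. T \<omega> \<le> t}" by simp
      qed auto
      finally show ?thesis .
    qed
    then show ?thesis using filtration_right_continuous[OF t] by auto
  qed
  then show "Measurable.pred (F t) (\<lambda>\<omega>. T \<omega> \<le> t)"
    by (simp add: pred_def space_F)
qed


lemma emeasure_start: "emeasure (P x) {\<omega>\<in>\<Omega>. X 0 \<omega> = ereal z} = (if x = z then 1 else 0)"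
proof -
  interpret prob_space "P x" by (rule prob_space_P)
  have m: "{\<omega>\<in>\<Omega>. X 0 \<omega> = ereal z} \<in> sets (P x)"
    using measurable_sets[OF measurable_F_mono[OF adapted[of 0], of \<infinity>], of "{ereal z}"]
    by (simp add: sets_P vimage_def Int_def space_F conj_commute)
  show ?thesis
  proof (cases "x = z")
    case True
    have "AE \<omega> in P x. \<omega> \<in> {\<omega>\<in>\<Omega>. X 0 \<omega> = ereal z}"
      using start[of x] AE_space by eventually_elim (use True space_P in auto)
    then show ?thesis using emeasure_eq_1_AE[OF m] True by simp
  next
    case False
    have "AE \<omega> in P x. \<omega> \<notin> {\<omega>\<in>\<Omega>. X 0 \<omega> = ereal z}"
      using start[of x] by eventually_elim (use False in auto)
    then have "emeasure (P x) {\<omega>\<in>\<Omega>. X 0 \<omega> = ereal z} = 0"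
      by (subst (asm) AE_iff_measurable[OF m]) (auto simp: space_P)
    then show ?thesis using False by simp
  qed
qed

text \<open>\<open>kernel_measurable\<close> is applied to the indicator of
  \<open>X 0 \<omega> = ereal z\<close>. Started from \<open>y\<close>, its expectation is 1 if
  \<open>y = z\<close> and 0 otherwise, so the event is a level set of a function measurable with
  respect to \<open>pre_sigma T\<close>.\<close>

lemma stopped_at_point_sets:
  assumes "stopping_time F T"
  shows "{\<omega>\<in>\<Omega>. X (T \<omega>) \<omega> = ereal z} \<in> sets (pre_sigma T)"
proof -
  let ?Z = "indicator {\<omega>\<in>\<Omega>. X 0 \<omega> = ereal z} :: 'a \<Rightarrow> ennreal"
  let ?H = "\<lambda>\<omega>. if X (T \<omega>) \<omega> = \<infinity> then 0 else \<integral>\<^sup>+ \<omega>'. ?Z \<omega>' \<partial>P (real_of_ereal (X (T \<omega>) \<omega>))"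
  have m: "{\<omega>\<in>\<Omega>. X 0 \<omega> = ereal z} \<in> sets (F \<infinity>)"
    using measurable_sets[OF measurable_F_mono[OF adapted[of 0], of \<infinity>], of "{ereal z}"]
    by (simp add: vimage_def Int_def space_F conj_commute)
  then have "?H \<in> borel_measurable (pre_sigma T)"
    by (intro kernel_measurable assms borel_measurable_indicator)
  from measurable_sets[OF this, of "{1}"]
  have "{\<omega>\<in>\<Omega>. ?H \<omega> = 1} \<in> sets (pre_sigma T)"
    by (simp add: vimage_def Int_def space_pre_sigma conj_commute)
  also have "{\<omega>\<in>\<Omega>. ?H \<omega> = 1} = {\<omega>\<in>\<Omega>. X (T \<omega>) \<omega> = ereal z}"
  proof (intro Collect_cong conj_cong refl)
    fix \<omega> assume "\<omega> \<in> \<Omega>"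
    then have "X (T \<omega>) \<omega> \<noteq> -\<infinity>" by (rule not_minus_infinity)
    moreover have "(\<integral>\<^sup>+ \<omega>'. ?Z \<omega>' \<partial>P y) = (if y = z then 1 else 0)" for y
      using m emeasure_start[of y z] by (simp add: sets_P)
    ultimately show "?H \<omega> = 1 \<longleftrightarrow> X (T \<omega>) \<omega> = ereal z"
      by (cases "X (T \<omega>) \<omega>") auto
  qed
  finally show ?thesis .
qed

lemma pre_sigma_sets_P:
  assumes "stopping_time F T" "G \<in> sets (pre_sigma T)"
  shows "G \<in> sets (P x)"
  using sets_pre_sigmaD[OF assms, of \<infinity>] by (simp add: sets_P)

lemma strong_Markov_space:
  assumes "stopping_time F T" "Z \<in> borel_measurable (F \<infinity>)"
  shows "(\<integral>\<^sup>+ \<omega>. (if X (T \<omega>) \<omega> = \<infinity> then 0 else Z (\<theta> (T \<omega>) \<omega>)) \<partial>P x) =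
    (\<integral>\<^sup>+ \<omega>. (if X (T \<omega>) \<omega> = \<infinity> then 0
      else \<integral>\<^sup>+ \<omega>'. Z \<omega>' \<partial>P (real_of_ereal (X (T \<omega>) \<omega>))) \<partial>P x)"
proof -
  have "\<Omega> \<in> sets (pre_sigma T)"
    using sets.top[of "pre_sigma T"] by (simp add: space_pre_sigma)
  note SM = strong_Markov[OF assms this, of x]
  have *: "(\<integral>\<^sup>+ \<omega>. (if X (T \<omega>) \<omega> = \<infinity> then 0 else f \<omega>) \<partial>P x) =
      (\<integral>\<^sup>+ \<omega>\<in>{\<omega>\<in>\<Omega>. X (T \<omega>) \<omega> \<noteq> \<infinity>}. f \<omega> \<partial>P x)" for f :: "'a \<Rightarrow> ennreal"
    by (rule nn_integral_cong) (simp add: space_P indicator_def)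
  show ?thesis unfolding * by (rule SM)
qed


lemma first_increase_le: "0 < A t \<omega> \<Longrightarrow> first_increase A \<omega> \<le> t"
  unfolding first_increase_def by (rule Inf_lower) simp

end

section \<open>Decomposition at the first increase of another local time\<close>

context transient_markov_potential
begin

lemma L_caf: "continuous_additive_functional (L y)"
  using local_times[of y] by (simp add: local_time_at_def)

lemma AE_first_increase_zero: "AE \<omega> in P y. first_increase (L y) \<omega> = 0"
  using local_times[of y] by (simp add: local_time_at_def)

lemma AE_first_increase_nonzero: "x \<noteq> y \<Longrightarrow> AE \<omega> in P x. first_increase (L y) \<omega> \<noteq> 0"
  using local_times[of y] by (simp add: local_time_at_def)

text \<open>Started off \<open>J\<close>, each of the finitely many local times has a positive first
  increase, so all of them vanish at any time \<open>q\<close> below the smallest one.\<close>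

lemma AE_local_time_sum_vanishes:
  assumes "finite J" "x \<notin> J" "\<And>a b. a < b \<Longrightarrow> \<exists>d\<in>D. a < d \<and> d < b"
  shows "AE \<omega> in P x. \<exists>q\<in>D. 0 < q \<and> (\<Sum>y\<in>J. L y q \<omega>) = 0"
proof -
  have "AE \<omega> in P x. \<forall>y\<in>J. first_increase (L y) \<omega> \<noteq> 0"
    using assms by (intro AE_finite_allI AE_first_increase_nonzero) auto
  then show ?thesis
  proof eventually_elim
    case (elim \<omega>)
    \<comment> \<open>The inserted \<open>1\<close> covers an empty \<open>J\<close>.\<close>
    define b where "b = Min (insert 1 ((\<lambda>y. first_increase (L y) \<omega>) ` J))"
    have "b \<in> insert 1 ((\<lambda>y. first_increase (L y) \<omega>) ` J)"
      unfolding b_def using assms(1) by (intro Min_in) auto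
    then have "0 < b" using elim by (auto simp: zero_less_iff_neq_zero)
    then obtain q where q: "q \<in> D" "0 < q" "q < b" using assms(3) by blast
    have "L y q \<omega> = 0" if "y \<in> J" for y
    proof (rule ccontr)
      assume "L y q \<omega> \<noteq> 0"
      then have "first_increase (L y) \<omega> \<le> q"
        by (intro first_increase_le) (simp add: zero_less_iff_neq_zero)
      moreover have "b \<le> first_increase (L y) \<omega>"
        unfolding b_def using assms(1) that by (intro Min_le) auto
      ultimately show False using q by simp
    qed
    then show ?case using q by (auto intro!: bexI[of _ q])
  qed
qed

text \<open>The weights \<open>w\<close> are the hitting probabilities of the other points of \<open>E\<close> at the first time
  one of their local times increases, and \<open>l\<close> is the expected local time at \<open>x\<close> spent before.\<close>

lemma potential_decomposition:
  assumes E: "finite E" "x \<in> E"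
  shows "\<exists>w l. 0 < l \<and> (\<forall>z. 0 \<le> w z) \<and> (\<Sum>z\<in>E - {x}. w z) \<le> 1 \<and>
    (\<forall>y\<in>E. u x y = (if y = x then l else 0) + (\<Sum>z\<in>E - {x}. w z * u z y))"
proof -
  interpret prob_space "P x" by (rule prob_space_P)
  define J where "J = E - {x}"
  have J: "finite J" "x \<notin> J" using E by (auto simp: J_def)
  obtain D :: "ennreal set" where D: "countable D" "\<And>a b. a < b \<Longrightarrow> \<exists>d\<in>D. a < d \<and> d < b"
    using ennreal_countable_dense by blast
  define A where "A t \<omega> = (\<Sum>y\<in>J. L y t \<omega>)" for t \<omega>
  \<comment> \<open>The infimum runs over the countable \<open>D\<close>, so that
    \<open>T \<omega> < t\<close> is a countable union of events of \<open>F t\<close>.\<close>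
  define T where "T \<omega> = Inf {d\<in>D. 0 < A d \<omega>}" for \<omega>
  have A_caf: "continuous_additive_functional A"
    unfolding A_def[abs_def] by (rule continuous_additive_functional_sum[OF J(1) L_caf])
  have A_meas: "A d \<in> borel_measurable (F t)" if "d \<le> t" for d t
    by (rule measurable_F_mono[OF continuous_additive_functional_measurable[OF A_caf] that])
  have T: "stopping_time F T"
  proof (rule stopping_timeI_less)
    fix t
    have "(\<Union>d\<in>D \<inter> {..<t}. {\<omega>\<in>\<Omega>. 0 < A d \<omega>}) \<in> sets (F t)"
    proof (rule sets.countable_UN')
      show "countable (D \<inter> {..<t})" using D by blast
      have "{\<omega>\<in>\<Omega>. 0 < A d \<omega>} \<in> sets (F t)" if "d \<in> D \<inter> {..<t}" for d
      proof -
        have "A d \<in> borel_measurable (F t)" using that by (intro A_meas) auto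
        from measurable_sets[OF this, of "{0<..}"] show ?thesis
          by (simp add: vimage_def Int_def space_F conj_commute)
      qed
      then show "(\<lambda>d. {\<omega>\<in>\<Omega>. 0 < A d \<omega>}) ` (D \<inter> {..<t}) \<subseteq> sets (F t)"
        by blast
    qed
    also have "(\<Union>d\<in>D \<inter> {..<t}. {\<omega>\<in>\<Omega>. 0 < A d \<omega>}) = {\<omega>\<in>\<Omega>. T \<omega> < t}"
      by (auto simp: T_def Inf_less_iff)
    finally show "{\<omega>\<in>\<Omega>. T \<omega> < t} \<in> sets (F t)" .
  qed
  \<comment> \<open>By continuity \<open>A\<close> is still 0 at its first increase: a positive
    value at \<open>T \<omega>\<close> would persist at some \<open>d\<close> in \<open>D\<close>
    just to the left, below the infimum.\<close>
  have AE_A: "AE \<omega> in P x. A (T \<omega>) \<omega> = 0 \<and> (\<forall>t>T \<omega>. 0 < A t \<omega>)"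
    using continuous_additive_functional_AE[OF A_caf, of x]
  proof eventually_elim
    case (elim \<omega>)
    then have mono: "s \<le> t \<Longrightarrow> A s \<omega> \<le> A t \<omega>" for s t by (auto dest: monoD)
    have cont: "continuous_on UNIV (\<lambda>t. A t \<omega>)" using elim by blast
    have "A (T \<omega>) \<omega> = 0"
    proof (rule ccontr)
      assume pos: "A (T \<omega>) \<omega> \<noteq> 0"
      then have "T \<omega> \<noteq> 0" using elim by metis
      then have 0: "0 < T \<omega>" by (simp add: zero_less_iff_neq_zero)
      have "open ((\<lambda>t. A t \<omega>) -` {0<..})"
        using cont by (rule open_vimage[OF open_greaterThan])
      moreover have "T \<omega> \<in> (\<lambda>t. A t \<omega>) -` {0<..}"
        using pos by (simp add: zero_less_iff_neq_zero)
      ultimately obtain b where b: "b < T \<omega>" "{b<..T \<omega>} \<subseteq> (\<lambda>t. A t \<omega>) -` {0<..}"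
        using open_left[OF _ _ 0] by blast
      obtain d where d: "d \<in> D" "b < d" "d < T \<omega>" using D(2)[OF b(1)] by blast
      then have "d \<in> {b<..T \<omega>}" by simp
      then have "0 < A d \<omega>" using b(2) by blast
      then have "T \<omega> \<le> d" unfolding T_def using d by (intro Inf_lower) auto
      then show False using d by simp
    qed
    moreover have "0 < A t \<omega>" if t: "T \<omega> < t" for t
    proof -
      obtain d where "d < t" "0 < A d \<omega>"
        using t unfolding T_def Inf_less_iff by auto
      then show ?thesis using mono[of d t] by (auto intro: less_le_trans)
    qed
    ultimately show ?case by simp
  qed

  have vanish: "AE \<omega> in P y. \<exists>q\<in>D. 0 < q \<and> A q \<omega> = 0" if "y \<notin> J" for y
    unfolding A_def by (rule AE_local_time_sum_vanishes[OF J(1) that]) (rule D(2))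
  have point_sets: "{\<omega>\<in>\<Omega>. X (T \<omega>) \<omega> = ereal z} \<in> sets (P x)" for z
    by (rule pre_sigma_sets_P[OF T stopped_at_point_sets[OF T]])
  have alive_sets: "{\<omega>\<in>\<Omega>. X (T \<omega>) \<omega> \<noteq> \<infinity>} \<in> sets (P x)"
  proof -
    have "(\<lambda>\<omega>. if X (T \<omega>) \<omega> = \<infinity> then 0 else (1 :: ennreal)) \<in> borel_measurable (F \<infinity>)"
      using shift_measurable[OF T, of "\<lambda>_. 1"] by simp
    then have "(\<lambda>\<omega>. if X (T \<omega>) \<omega> = \<infinity> then 0 else (1 :: ennreal)) -` {1} \<inter> space (F \<infinity>) \<in> sets (F \<infinity>)"
      by (rule measurable_sets) simp
    also have "(\<lambda>\<omega>. if X (T \<omega>) \<omega> = \<infinity> then 0 else (1 :: ennreal)) -` {1} \<inter> space (F \<infinity>) =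
        {\<omega>\<in>\<Omega>. X (T \<omega>) \<omega> \<noteq> \<infinity>}"
      by (auto simp: space_F split: if_splits)
    also have "sets (F \<infinity>) = sets (P x)" by (simp add: sets_P)
    finally show ?thesis .
  qed
  have hit_sets: "{\<omega>\<in>\<Omega>. X (T \<omega>) \<omega> \<in> ereal ` J} \<in> sets (P x)"
  proof -
    have "{\<omega>\<in>\<Omega>. X (T \<omega>) \<omega> \<in> ereal ` J} = (\<Union>z\<in>J. {\<omega>\<in>\<Omega>. X (T \<omega>) \<omega> = ereal z})" by auto
    then show ?thesis using J point_sets by auto
  qed
  \<comment> \<open>After \<open>T\<close> the functional \<open>A\<close> increases at once, so a
    path alive at \<open>T\<close> is shifted into \<open>B\<close>. But \<open>B\<close> is a null
    event for every starting point off \<open>J\<close>, so by the strong Markov property the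
    probability of being alive at \<open>T\<close> is at most that of being in
    \<open>J\<close>.\<close>
  have AE_hit: "AE \<omega> in P x. X (T \<omega>) \<omega> \<noteq> \<infinity> \<longrightarrow> X (T \<omega>) \<omega> \<in> ereal ` J"
  proof -
    define B where "B = {\<omega>\<in>\<Omega>. \<forall>d\<in>D. 0 < d \<longrightarrow> 0 < A d \<omega>}"
    have B: "B \<in> sets (F \<infinity>)"
    proof -
      have [measurable]: "A d \<in> borel_measurable (F \<infinity>)" for d by (rule A_meas) simp
      have "D \<noteq> {}" using D(2)[of 0 1] by auto
      then have range: "range (from_nat_into D) = D" using D(1) by (rule range_from_nat_into)
      have "Measurable.pred (F \<infinity>)
          (\<lambda>\<omega>. \<forall>n. 0 < from_nat_into D n \<longrightarrow> 0 < A (from_nat_into D n) \<omega>)"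
        by measurable
      also have "(\<lambda>\<omega>. \<forall>n. 0 < from_nat_into D n \<longrightarrow> 0 < A (from_nat_into D n) \<omega>) =
          (\<lambda>\<omega>. \<forall>d\<in>D. 0 < d \<longrightarrow> 0 < A d \<omega>)"
        by (subst (3) range[symmetric]) blast
      finally have "Measurable.pred (F \<infinity>) (\<lambda>\<omega>. \<forall>d\<in>D. 0 < d \<longrightarrow> 0 < A d \<omega>)" .
      then show ?thesis by (simp add: B_def pred_def space_F)
    qed
    have PB: "(\<integral>\<^sup>+ \<omega>'. indicator B \<omega>' \<partial>P y) = 0" if "y \<notin> J" for y
    proof -
      have "AE \<omega> in P y. \<omega> \<notin> B"
        using vanish[OF that]
        by eventually_elim (auto simp: B_def)
      then have "AE \<omega> in P y. indicator B \<omega> = (0::ennreal)"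
        by eventually_elim simp
      then show ?thesis by (subst nn_integral_cong_AE) auto
    qed
    have "emeasure (P x) {\<omega>\<in>\<Omega>. X (T \<omega>) \<omega> \<noteq> \<infinity>} =
        (\<integral>\<^sup>+ \<omega>. indicator {\<omega>\<in>\<Omega>. X (T \<omega>) \<omega> \<noteq> \<infinity>} \<omega> \<partial>P x)"
      using alive_sets by simp
    also have "\<dots> = (\<integral>\<^sup>+ \<omega>. (if X (T \<omega>) \<omega> = \<infinity> then 0 else indicator B (\<theta> (T \<omega>) \<omega>)) \<partial>P x)"
    proof (rule nn_integral_cong_AE)
      show "AE \<omega> in P x. indicator {\<omega>\<in>\<Omega>. X (T \<omega>) \<omega> \<noteq> \<infinity>} \<omega> =
          (if X (T \<omega>) \<omega> = \<infinity> then 0 else indicator B (\<theta> (T \<omega>) \<omega>) :: ennreal)"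
        using AE_A continuous_additive_functional_AE[OF A_caf, of x] AE_space
      proof eventually_elim
        case (elim \<omega>)
        show ?case
        proof (cases "X (T \<omega>) \<omega> = \<infinity>")
          case False
          have \<omega>: "\<omega> \<in> \<Omega>" using elim space_P by simp
          have fin: "T \<omega> < \<infinity>"
            using cemetery_at_infinity[OF \<omega>] False by (metis infinity_ennreal_def top.not_eq_extremum)
          have "0 < A d (\<theta> (T \<omega>) \<omega>)" if "0 < d" for d
          proof -
            have "T \<omega> + 0 < T \<omega> + d"
              using that fin by (subst ennreal_add_left_cancel_less) auto
            then have "0 < A (T \<omega> + d) \<omega>" using elim by simp
            then show ?thesis using elim fin by simp
          qed
          then have "\<theta> (T \<omega>) \<omega> \<in> B" unfolding B_def using shift_closed[OF \<omega> fin] by simp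
          then show ?thesis using False \<omega> by simp
        qed simp
      qed
    qed
    also have "\<dots> = (\<integral>\<^sup>+ \<omega>. (if X (T \<omega>) \<omega> = \<infinity> then 0
        else \<integral>\<^sup>+ \<omega>'. indicator B \<omega>' \<partial>P (real_of_ereal (X (T \<omega>) \<omega>))) \<partial>P x)"
      by (rule strong_Markov_space[OF T]) (use B in simp)
    also have "\<dots> \<le> (\<integral>\<^sup>+ \<omega>. indicator {\<omega>\<in>\<Omega>. X (T \<omega>) \<omega> \<in> ereal ` J} \<omega> \<partial>P x)"
    proof (rule nn_integral_mono)
      fix \<omega> assume "\<omega> \<in> space (P x)"
      then have \<omega>: "\<omega> \<in> \<Omega>" by (simp add: space_P)
      show "(if X (T \<omega>) \<omega> = \<infinity> then 0
          else \<integral>\<^sup>+ \<omega>'. indicator B \<omega>' \<partial>P (real_of_ereal (X (T \<omega>) \<omega>)))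
          \<le> (indicator {\<omega>\<in>\<Omega>. X (T \<omega>) \<omega> \<in> ereal ` J} \<omega> :: ennreal)"
      proof (cases "X (T \<omega>) \<omega>")
        case (real y)
        interpret y: prob_space "P y" by (rule prob_space_P)
        show ?thesis
        proof (cases "y \<in> J")
          case True
          then have "\<omega> \<in> {\<omega>\<in>\<Omega>. X (T \<omega>) \<omega> \<in> ereal ` J}" using real \<omega> by simp
          moreover have "emeasure (P y) B \<le> 1" by (rule y.emeasure_le_1)
          ultimately show ?thesis using real B by (simp add: sets_P)
        qed (simp add: real PB)
      qed (use not_minus_infinity[OF \<omega>] in auto)
    qed
    also have "\<dots> = emeasure (P x) {\<omega>\<in>\<Omega>. X (T \<omega>) \<omega> \<in> ereal ` J}"
      using hit_sets by simp
    finally have le: "emeasure (P x) {\<omega>\<in>\<Omega>. X (T \<omega>) \<omega> \<noteq> \<infinity>} \<le>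
      emeasure (P x) {\<omega>\<in>\<Omega>. X (T \<omega>) \<omega> \<in> ereal ` J}" .
    have "emeasure (P x) ({\<omega>\<in>\<Omega>. X (T \<omega>) \<omega> \<noteq> \<infinity>} - {\<omega>\<in>\<Omega>. X (T \<omega>) \<omega> \<in> ereal ` J}) = 0"
      using le alive_sets hit_sets
      by (subst emeasure_Diff) (auto simp: diff_eq_0_iff_ennreal less_top[symmetric])
    then have "{\<omega>\<in>\<Omega>. X (T \<omega>) \<omega> \<noteq> \<infinity>} - {\<omega>\<in>\<Omega>. X (T \<omega>) \<omega> \<in> ereal ` J} \<in> null_sets (P x)"
      using alive_sets hit_sets by (intro null_setsI sets.Diff)
    then show ?thesis by (rule AE_I') (auto simp: space_P)
  qed

  define W where "W y \<omega> = (if X (T \<omega>) \<omega> = \<infinity> then 0 else L y \<infinity> (\<theta> (T \<omega>) \<omega>))" for y \<omega>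
  define w where "w z = prob {\<omega>\<in>\<Omega>. X (T \<omega>) \<omega> = ereal z}" for z
  have L_meas: "L y \<infinity> \<in> borel_measurable (F \<infinity>)" for y
    by (rule continuous_additive_functional_measurable[OF L_caf])
  have W_meas: "W y \<in> borel_measurable (F \<infinity>)" for y
    unfolding W_def[abs_def] by (rule shift_measurable[OF T L_meas])
  have W_integral: "(\<integral>\<^sup>+ \<omega>. W y \<omega> \<partial>P x) = ennreal (\<Sum>z\<in>J. w z * u z y)" for y
  proof -
    have "(\<integral>\<^sup>+ \<omega>. W y \<omega> \<partial>P x) = (\<integral>\<^sup>+ \<omega>. (if X (T \<omega>) \<omega> = \<infinity> then 0
        else ennreal (u (real_of_ereal (X (T \<omega>) \<omega>)) y)) \<partial>P x)"
      unfolding W_def by (simp only: strong_Markov_space[OF T L_meas] u_local_time)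
    also have "\<dots> = (\<integral>\<^sup>+ \<omega>. (\<Sum>z\<in>J. ennreal (u z y) * indicator {\<omega>\<in>\<Omega>. X (T \<omega>) \<omega> = ereal z} \<omega>) \<partial>P x)"
    proof (rule nn_integral_cong_AE)
      show "AE \<omega> in P x. (if X (T \<omega>) \<omega> = \<infinity> then 0 else ennreal (u (real_of_ereal (X (T \<omega>) \<omega>)) y)) =
          (\<Sum>z\<in>J. ennreal (u z y) * indicator {\<omega>\<in>\<Omega>. X (T \<omega>) \<omega> = ereal z} \<omega>)"
        using AE_hit AE_space
      proof eventually_elim
        case (elim \<omega>)
        then have \<omega>: "\<omega> \<in> \<Omega>" by (simp add: space_P)
        show ?case
        proof (cases "X (T \<omega>) \<omega> = \<infinity>")
          case False
          then obtain a where a: "a \<in> J" "X (T \<omega>) \<omega> = ereal a" using elim by blast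
          have "(\<Sum>z\<in>J. ennreal (u z y) * indicator {\<omega>\<in>\<Omega>. X (T \<omega>) \<omega> = ereal z} \<omega>) =
              (\<Sum>z\<in>J. if a = z then ennreal (u z y) else 0)"
            using a \<omega> by (intro sum.cong) auto
          then show ?thesis using a J by simp
        qed simp
      qed
    qed
    also have "\<dots> = (\<Sum>z\<in>J. ennreal (u z y) * emeasure (P x) {\<omega>\<in>\<Omega>. X (T \<omega>) \<omega> = ereal z})"
      using point_sets by (subst nn_integral_sum) (auto simp: nn_integral_cmult_indicator)
    also have "\<dots> = (\<Sum>z\<in>J. ennreal (w z * u z y))"
      by (intro sum.cong refl)
        (simp add: w_def emeasure_eq_measure ennreal_mult[symmetric] u_nonneg mult.commute)
    also have "\<dots> = ennreal (\<Sum>z\<in>J. w z * u z y)"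
      by (rule sum_ennreal) (simp add: w_def u_nonneg)
    finally show ?thesis .
  qed
  \<comment> \<open>If the process is dead at \<open>T\<close>, the local time no longer increases;
    if it is alive, additivity applies at \<open>T\<close> with the remaining time
    \<open>\<infinity>\<close>.\<close>
  have L_split: "AE \<omega> in P x. L y \<infinity> \<omega> = L y (T \<omega>) \<omega> + W y \<omega>" for y
    using continuous_additive_functional_AE[OF L_caf[of y], of x] AE_space
  proof eventually_elim
    case (elim \<omega>)
    then have \<omega>: "\<omega> \<in> \<Omega>" by (simp add: space_P)
    show ?case
    proof (cases "X (T \<omega>) \<omega> = \<infinity>")
      case True
      moreover have "T \<omega> \<le> \<infinity>" by simp
      ultimately have "L y \<infinity> \<omega> = L y (T \<omega>) \<omega>" using elim by blast
      then show ?thesis using True by (simp add: W_def)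
    next
      case False
      then have fin: "T \<omega> < \<infinity>"
        using cemetery_at_infinity[OF \<omega>] by (metis infinity_ennreal_def top.not_eq_extremum)
      then have "L y (T \<omega> + \<infinity>) \<omega> = L y (T \<omega>) \<omega> + L y \<infinity> (\<theta> (T \<omega>) \<omega>)" using elim by blast
      then show ?thesis using False by (simp add: W_def)
    qed
  qed
  have off: "u x y = (\<Sum>z\<in>J. w z * u z y)" if y: "y \<in> J" for y
  proof -
    have "AE \<omega> in P x. L y \<infinity> \<omega> = W y \<omega>"
      using L_split[of y] AE_A
    proof eventually_elim
      case (elim \<omega>)
      then have "L y (T \<omega>) \<omega> = 0" using y J by (simp add: A_def)
      then show ?case using elim by simp
    qed
    then have "ennreal (u x y) = ennreal (\<Sum>z\<in>J. w z * u z y)"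
      unfolding u_local_time[symmetric] W_integral[symmetric] by (rule nn_integral_cong_AE)
    then show ?thesis by (simp add: u_nonneg sum_nonneg w_def)
  qed
  \<comment> \<open>Almost surely this is \<open>L x (T \<omega>) \<omega>\<close>, because the
    total local time is finite; in the form of a difference its measurability is immediate.\<close>
  define R where "R \<omega> = L x \<infinity> \<omega> - W x \<omega>" for \<omega>
  have R_meas: "R \<in> borel_measurable (P x)"
    unfolding R_def[abs_def] measurable_P using L_meas W_meas by measurable
  have L_finite: "AE \<omega> in P x. L x \<infinity> \<omega> \<noteq> \<infinity>"
    using L_meas u_local_time[of x x] by (intro nn_integral_PInf_AE) (simp_all add: measurable_P)
  have "ennreal (u x x) = (\<integral>\<^sup>+ \<omega>. R \<omega> + W x \<omega> \<partial>P x)"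
    unfolding u_local_time[symmetric]
  proof (rule nn_integral_cong_AE)
    show "AE \<omega> in P x. L x \<infinity> \<omega> = R \<omega> + W x \<omega>"
      using L_split[of x]
    proof eventually_elim
      case (elim \<omega>)
      then show ?case unfolding R_def by (simp add: diff_add_cancel_ennreal)
    qed
  qed
  also have "\<dots> = (\<integral>\<^sup>+ \<omega>. R \<omega> \<partial>P x) + ennreal (\<Sum>z\<in>J. w z * u z x)"
    unfolding W_integral[symmetric]
    using R_meas W_meas by (intro nn_integral_add) (simp_all add: measurable_P)
  finally have uxx: "ennreal (u x x) = (\<integral>\<^sup>+ \<omega>. R \<omega> \<partial>P x) + ennreal (\<Sum>z\<in>J. w z * u z x)" .
  define l where "l = enn2real (\<integral>\<^sup>+ \<omega>. R \<omega> \<partial>P x)"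
  have R_finite: "(\<integral>\<^sup>+ \<omega>. R \<omega> \<partial>P x) \<noteq> \<infinity>" using uxx by auto
  \<comment> \<open>Since \<open>x\<close> is not in \<open>J\<close>, the functional
    \<open>A\<close> stays 0 for a while and \<open>T\<close> is positive, whereas the local time at
    \<open>x\<close> increases immediately. Hence a positive amount is collected by time
    \<open>T\<close>.\<close>
  have R_pos: "(\<integral>\<^sup>+ \<omega>. R \<omega> \<partial>P x) \<noteq> 0"
  proof
    assume "(\<integral>\<^sup>+ \<omega>. R \<omega> \<partial>P x) = 0"
    then have "AE \<omega> in P x. R \<omega> = 0"
      using R_meas by (simp add: nn_integral_0_iff_AE)
    then have "AE \<omega> in P x. False"
      using L_split[of x] L_finite AE_first_increase_zero[of x] AE_A
        continuous_additive_functional_AE[OF L_caf[of x], of x]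
        vanish[OF J(2)]
    proof eventually_elim
      case (elim \<omega>)
      obtain q where q: "0 < q" "A q \<omega> = 0" using elim(7) by blast
      have "\<not> T \<omega> < q"
      proof
        assume "T \<omega> < q"
        then have "0 < A q \<omega>" using elim(5) by blast
        then show False using q by simp
      qed
      then have "0 < T \<omega>" using q by simp
      then have "Inf {t. 0 < L x t \<omega>} < T \<omega>" using elim(4) by (simp add: first_increase_def)
      then obtain t where t: "0 < L x t \<omega>" "t < T \<omega>" unfolding Inf_less_iff by auto
      have "mono (\<lambda>t. L x t \<omega>)" using elim(6) by blast
      then have "L x t \<omega> \<le> L x (T \<omega>) \<omega>" using t by (intro monoD[of "\<lambda>t. L x t \<omega>"]) auto
      then have "0 < L x (T \<omega>) \<omega>" using t by simp
      moreover have "W x \<omega> \<noteq> \<infinity>" using elim(2,3) by auto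
      then have "R \<omega> = L x (T \<omega>) \<omega>"
        unfolding R_def using elim(2) by simp
      ultimately show ?case using elim(1) by simp
    qed
    then show False by simp
  qed
  have l: "0 < l" "(\<integral>\<^sup>+ \<omega>. R \<omega> \<partial>P x) = ennreal l"
    using R_finite R_pos by (simp_all add: l_def enn2real_positive_iff less_top zero_less_iff_neq_zero)
  have eq: "ennreal (u x x) = ennreal (l + (\<Sum>z\<in>J. w z * u z x))"
    using uxx l by (simp add: ennreal_plus sum_nonneg w_def u_nonneg)
  have "0 \<le> (\<Sum>z\<in>J. w z * u z x)"
    by (intro sum_nonneg) (simp add: w_def u_nonneg)
  then have on: "u x x = l + (\<Sum>z\<in>J. w z * u z x)"
    using eq l by (subst (asm) ennreal_inj) (auto simp: u_nonneg)
  have "(\<Sum>z\<in>J. w z) = prob (\<Union>z\<in>J. {\<omega>\<in>\<Omega>. X (T \<omega>) \<omega> = ereal z})"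
    unfolding w_def using J point_sets
    by (intro finite_measure_finite_Union[symmetric]) (auto simp: disjoint_family_on_def)
  also have "\<dots> \<le> 1" by (rule prob_le_1)
  finally have "(\<Sum>z\<in>J. w z) \<le> 1" .
  then show ?thesis
    using l on off by (intro exI[of _ w] exI[of _ l]) (auto simp: J_def w_def)
qed

text \<open>In matrix form \<open>(I - w) K = diag l\<close>: up to the row scaling by
  \<open>1 / l i\<close>, the matrix \<open>I - w\<close> is the inverse of the kernel matrix
  \<open>K\<close>. Injectivity lets points be replaced by indices.\<close>

lemma potential_matrix_decomposition:
  fixes t :: "nat \<Rightarrow> real"
  assumes inj: "inj_on t {..<n}"
  obtains w l where "\<And>i. i < n \<Longrightarrow> 0 < l i" "\<And>i j. i < n \<Longrightarrow> 0 \<le> w i j" "\<And>i. w i i = 0"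
    "\<And>i. i < n \<Longrightarrow> (\<Sum>j<n. w i j) \<le> 1"
    "\<And>i j. i < n \<Longrightarrow> j < n \<Longrightarrow>
      u (t i) (t j) = (if i = j then l i else 0) + (\<Sum>k<n. w i k * u (t k) (t j))"
proof -
  let ?E = "t ` {..<n}"
  define Q where "Q i v l \<longleftrightarrow> 0 < l \<and> (\<forall>z. 0 \<le> v z) \<and> (\<Sum>z\<in>?E - {t i}. v z) \<le> 1 \<and>
    (\<forall>y\<in>?E. u (t i) y = (if y = t i then l else 0) + (\<Sum>z\<in>?E - {t i}. v z * u z y))" for i v l
  have "\<exists>v l. Q i v l" if "i < n" for i
    unfolding Q_def by (rule potential_decomposition) (use that in auto)
  then have "\<forall>i. \<exists>v. i < n \<longrightarrow> (\<exists>l. Q i v l)" by blast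
  from choice[OF this] obtain v where "\<forall>i. i < n \<longrightarrow> (\<exists>l. Q i (v i) l)" ..
  then have "\<forall>i. \<exists>l. i < n \<longrightarrow> Q i (v i) l" by blast
  from choice[OF this] obtain l where "\<forall>i. i < n \<longrightarrow> Q i (v i) (l i)" ..
  then have Q: "0 < l i" "0 \<le> v i z" "(\<Sum>z\<in>?E - {t i}. v i z) \<le> 1"
    "y \<in> ?E \<Longrightarrow> u (t i) y = (if y = t i then l i else 0) + (\<Sum>z\<in>?E - {t i}. v i z * u z y)"
    if "i < n" for i y z
    using that by (auto simp: Q_def)
  define w where "w i j = (if i = j then 0 else v i (t j))" for i j
  have reindex: "(\<Sum>z\<in>?E - {t i}. v i z * f z) = (\<Sum>k<n. w i k * f (t k))" if i: "i < n" for i f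
  proof -
    have "?E - {t i} = t ` ({..<n} - {i})" using inj i by (auto simp: inj_on_def)
    then have "(\<Sum>z\<in>?E - {t i}. v i z * f z) = (\<Sum>k\<in>{..<n} - {i}. v i (t k) * f (t k))"
      using inj by (simp add: sum.reindex inj_on_diff)
    also have "\<dots> = (\<Sum>k\<in>{..<n} - {i}. w i k * f (t k))"
      by (intro sum.cong) (auto simp: w_def)
    also have "\<dots> = (\<Sum>k<n. w i k * f (t k))"
      using i by (intro sum.mono_neutral_left) (auto simp: w_def)
    finally show ?thesis .
  qed
  show ?thesis
  proof (rule that[of l w])
    show "u (t i) (t j) = (if i = j then l i else 0) + (\<Sum>k<n. w i k * u (t k) (t j))"
      if "i < n" "j < n" for i j
      using Q(4)[OF that(1), of "t j"] reindex[OF that(1), of "\<lambda>z. u z (t j)"] that inj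
      by (auto simp: inj_on_eq_iff)
    show "(\<Sum>j<n. w i j) \<le> 1" if "i < n" for i
      using Q(3)[OF that] reindex[OF that, of "\<lambda>_. 1"] by simp
    show "0 \<le> w i j" if "i < n" for i j using Q(2)[OF that] by (simp add: w_def)
  qed (use Q(1) in \<open>auto simp: w_def\<close>)
qed

end

section \<open>Maxima of permanental vectors\<close>

lemma exp_minus_of_nat_mult_ln: "0 < a \<Longrightarrow> exp (- (real k * ln a)) = (1 / a) ^ k"
  by (simp only: exp_minus exp_of_nat_mult exp_ln power_one_over inverse_eq_divide)

lemma det_diagonal_mat: "Determinant.det (diagonal_mat n d) = (\<Prod>i<n. d i)"
proof -
  have "Determinant.det (diagonal_mat n d) = prod_list (diag_mat (diagonal_mat n d))"
    by (rule det_upper_triangular[where n=n]) (auto simp: diagonal_mat_def)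
  also have "\<dots> = (\<Prod>i<n. d i)"
    unfolding prod_list_diag_prod by (simp add: diagonal_mat_def atLeast0LessThan)
  finally show ?thesis .
qed

lemma index_mult_mat_mat:
  "i < n \<Longrightarrow> j < n \<Longrightarrow>
    (mat n n (\<lambda>(i, j). f i j) * mat n n (\<lambda>(i, j). g i j)) $$ (i, j) = (\<Sum>k<n. f i k * g k j)"
  by (simp add: scalar_prod_def atLeast0LessThan)

section \<open>Laplace transforms and maxima for a decomposed kernel matrix\<close>

context
  fixes u :: "real \<Rightarrow> real \<Rightarrow> real" and t :: "nat \<Rightarrow> real" and n :: nat
    and l :: "nat \<Rightarrow> real" and w :: "nat \<Rightarrow> nat \<Rightarrow> real"
  assumes l_pos: "\<And>i. i < n \<Longrightarrow> 0 < l i"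
    and w_nonneg: "\<And>i j. i < n \<Longrightarrow> 0 \<le> w i j"
    and w_sum: "\<And>i. i < n \<Longrightarrow> (\<Sum>j<n. w i j) \<le> 1"
    and decomposition: "\<And>i j. i < n \<Longrightarrow> j < n \<Longrightarrow>
      u (t i) (t j) = (if i = j then l i else 0) + (\<Sum>k<n. w i k * u (t k) (t j))"
begin

text \<open>With \<open>K\<close> the kernel matrix and \<open>S = diag s\<close>, the identity
  \<open>(I - w) K = diag l\<close> gives
  \<open>(I - w) (I + K S) = I - w + diag l * S\<close>.\<close>

lemma det_substochastic_mult:
  "Determinant.det (mat n n (\<lambda>(i, j). (if i = j then 1 else 0) - w i j)) *
    Determinant.det (1\<^sub>m n + kernel_mat u n t * diagonal_mat n s) =
  Determinant.det (mat n n (\<lambda>(i, j). (if i = j then 1 + l i * s i else 0) - w i j))"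
proof -
  have "kernel_mat u n t * diagonal_mat n s = mat n n (\<lambda>(i, j). u (t i) (t j) * s j)" (is "?K = ?R")
  proof (rule eq_matI)
    fix i j assume "i < dim_row ?R" "j < dim_col ?R"
    then have ij: "i < n" "j < n" by auto
    have "?K $$ (i, j) = (\<Sum>k<n. u (t i) (t k) * (if k = j then s k else 0))"
      unfolding kernel_mat_def diagonal_mat_def by (rule index_mult_mat_mat[OF ij])
    also have "\<dots> = (\<Sum>k<n. if k = j then u (t i) (t k) * s k else 0)"
      by (intro sum.cong) auto
    finally show "?K $$ (i, j) = ?R $$ (i, j)" using ij by simp
  qed (auto simp: kernel_mat_def diagonal_mat_def)
  then have "1\<^sub>m n + kernel_mat u n t * diagonal_mat n s =
      mat n n (\<lambda>(i, j). (if i = j then 1 else 0) + u (t i) (t j) * s j)"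
    by (intro eq_matI) auto
  moreover have "mat n n (\<lambda>(i, j). (if i = j then 1 else 0) - w i j) *
      mat n n (\<lambda>(i, j). (if i = j then 1 else 0) + u (t i) (t j) * s j) =
      mat n n (\<lambda>(i, j). (if i = j then 1 + l i * s i else 0) - w i j)" (is "?A * ?B = ?C")
  proof (rule eq_matI)
    fix i j assume "i < dim_row ?C" "j < dim_col ?C"
    then have ij: "i < n" "j < n" by auto
    have "(?A * ?B) $$ (i, j) =
        (\<Sum>k<n. ((if i = k then 1 else 0) - w i k) * ((if k = j then 1 else 0) + u (t k) (t j) * s j))"
      by (rule index_mult_mat_mat[OF ij])
    also have "\<dots> = (\<Sum>k<n. (if k = i then (if k = j then 1 else 0) + u (t k) (t j) * s j else 0) -
        (if k = j then w i k else 0) - w i k * u (t k) (t j) * s j)"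
      by (intro sum.cong refl) (auto simp: algebra_simps)
    also have "\<dots> = (if i = j then 1 else 0) + u (t i) (t j) * s j - w i j -
        (\<Sum>k<n. w i k * u (t k) (t j)) * s j"
      using ij by (simp add: sum_subtractf sum_distrib_right)
    also have "\<dots> = ?C $$ (i, j)"
      using ij by (subst decomposition[OF ij]) (auto simp: algebra_simps)
    finally show "(?A * ?B) $$ (i, j) = ?C $$ (i, j)" .
  qed auto
  ultimately show ?thesis
    by (subst det_mult[symmetric, of _ n]) (auto simp: kernel_mat_def)
qed

lemma det_substochastic_nonzero:
  "Determinant.det (mat n n (\<lambda>(i, j). (if i = j then 1 else 0) - w i j)) \<noteq> 0"
proof -
  have "mat n n (\<lambda>(i, j). (if i = j then 1 else 0) - w i j) * kernel_mat u n t = diagonal_mat n l"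
    (is "?A * ?B = ?C")
  proof (rule eq_matI)
    fix i j assume "i < dim_row ?C" "j < dim_col ?C"
    then have ij: "i < n" "j < n" by (auto simp: diagonal_mat_def)
    have "(?A * ?B) $$ (i, j) = (\<Sum>k<n. ((if i = k then 1 else 0) - w i k) * u (t k) (t j))"
      unfolding kernel_mat_def by (rule index_mult_mat_mat[OF ij])
    also have "\<dots> = (\<Sum>k<n. (if k = i then u (t k) (t j) else 0) - w i k * u (t k) (t j))"
      by (intro sum.cong refl) (auto simp: algebra_simps)
    also have "\<dots> = u (t i) (t j) - (\<Sum>k<n. w i k * u (t k) (t j))"
      using ij by (simp add: sum_subtractf)
    also have "\<dots> = ?C $$ (i, j)"
      using ij decomposition[OF ij] by (simp add: diagonal_mat_def)
    finally show "(?A * ?B) $$ (i, j) = ?C $$ (i, j)" .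
  qed (auto simp: diagonal_mat_def kernel_mat_def)
  then have "Determinant.det ?A * Determinant.det ?B = (\<Prod>i<n. l i)"
    by (subst det_mult[symmetric, of _ n]) (auto simp: kernel_mat_def det_diagonal_mat)
  moreover have "(\<Prod>i<n. l i) \<noteq> 0" using l_pos by (auto simp: less_imp_neq[symmetric])
  ultimately show ?thesis by auto
qed

text \<open>Dividing row \<open>i\<close> of \<open>I + diag l * S - w\<close> by
  \<open>1 + l i * s i\<close> leaves \<open>I - m\<close>, where each entry of \<open>m\<close> is
  a multiple of one factor of the mixtures and \<open>m\<close> is \<open>w\<close> at
  \<open>s = 0\<close>. So \<open>det_one_minus_mixture\<close> applies.\<close>

lemma det_powr_gamma_mixture:
  assumes "0 < \<alpha>"
  obtains f where "f \<in> gamma_mixtures n l" "f (\<lambda>_. 0) = 1"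
    "\<And>s. (\<forall>i<n. 0 \<le> s i) \<Longrightarrow>
      Determinant.det (1\<^sub>m n + kernel_mat u n t * diagonal_mat n s) powr (- \<alpha>) =
      (\<Prod>i<n. (1 + l i * s i) powr (- \<alpha>)) * f s"
proof -
  define m where "m i j s = w i j * (1 / (1 + l i * s i))" for i j and s :: "nat \<Rightarrow> real"
  define d where "d s = Determinant.det (mat n n (\<lambda>(i, j). (if i = j then 1 else 0) - m i j s))" for s
  have nn: "\<And>i. i < n \<Longrightarrow> 0 \<le> l i" using l_pos by (simp add: less_imp_le)
  have m: "m i j \<in> gamma_mixtures n l" if i: "i < n" "j < n" for i j
  proof -
    have "(\<lambda>s. w i j * (\<Prod>k<n. (1 / (1 + l k * s k)) ^ (if k = i then 1 else 0))) \<in> gamma_mixtures n l"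
      by (rule gamma_mixtures.monom[OF w_nonneg[OF i(1)]])
    moreover have "(\<Prod>k<n. (1 / (1 + l k * s k)) ^ (if k = i then 1 else 0)) = 1 / (1 + l i * s i)" for s
    proof -
      have "(\<Prod>k<n. (1 / (1 + l k * s k)) ^ (if k = i then 1 else 0)) =
          (\<Prod>k<n. if k = i then 1 / (1 + l k * s k) else 1)"
        by (rule prod.cong) auto
      then show ?thesis using i by simp
    qed
    ultimately show ?thesis unfolding m_def[abs_def] by simp
  qed
  have m0: "m i j (\<lambda>_. 0) = w i j" for i j by (simp add: m_def)
  have main: "(\<lambda>s. d s powr (- \<alpha>)) \<in> gamma_mixtures n l \<and> (\<forall>s. (\<forall>i<n. 0 \<le> s i) \<longrightarrow> 0 < d s)"
    unfolding d_def by (rule det_one_minus_mixture[OF nn assms m])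
      (auto simp: m0 w_sum det_substochastic_nonzero)
  define d0 where "d0 = d (\<lambda>_. 0)"
  have d0: "0 < d0" using main by (simp add: d0_def)
  have d0_eq: "d0 = Determinant.det (mat n n (\<lambda>(i, j). (if i = j then 1 else 0) - w i j))"
    by (simp add: d0_def d_def m0)
  \<comment> \<open>The factor \<open>d0 powr \<alpha>\<close> normalises the total mass of the
    mixture to 1.\<close>
  define f where "f s = d0 powr \<alpha> * d s powr (- \<alpha>)" for s
  show ?thesis
  proof (rule that[of f])
    show "f \<in> gamma_mixtures n l"
      unfolding f_def[abs_def] using main by (intro gamma_mixtures_mult gamma_mixtures_const) auto
    show "f (\<lambda>_. 0) = 1"
      using d0 by (simp add: f_def flip: d0_def powr_add)
    fix s :: "nat \<Rightarrow> real" assume s: "\<forall>i<n. 0 \<le> s i"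
    have pos: "0 < 1 + l i * s i" if "i < n" for i using nn s that by (simp add: add_pos_nonneg)
    have "mat n n (\<lambda>(i, j). (if i = j then 1 + l i * s i else 0) - w i j) =
        diagonal_mat n (\<lambda>i. 1 + l i * s i) * mat n n (\<lambda>(i, j). (if i = j then 1 else 0) - m i j s)"
      (is "?A = ?B * ?C")
    proof (rule eq_matI)
      fix i j assume "i < dim_row (?B * ?C)" "j < dim_col (?B * ?C)"
      then have ij: "i < n" "j < n" by (auto simp: diagonal_mat_def)
      have "(?B * ?C) $$ (i, j) = (\<Sum>k<n. (if i = k then 1 + l i * s i else 0) *
          ((if k = j then 1 else 0) - m k j s))"
        unfolding diagonal_mat_def by (rule index_mult_mat_mat[OF ij])
      also have "\<dots> = (\<Sum>k<n. if k = i then (1 + l i * s i) * ((if k = j then 1 else 0) - m k j s) else 0)"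
        by (intro sum.cong) auto
      also have "\<dots> = (1 + l i * s i) * ((if i = j then 1 else 0) - m i j s)"
        using ij by simp
      also have "\<dots> = ?A $$ (i, j)"
        using ij pos[of i] by (simp add: m_def right_diff_distrib)
      finally show "?A $$ (i, j) = (?B * ?C) $$ (i, j)" by simp
    qed (auto simp: diagonal_mat_def)
    then have "Determinant.det ?A = (\<Prod>i<n. 1 + l i * s i) * d s"
      unfolding d_def by (subst det_diagonal_mat[symmetric], subst det_mult[symmetric, of _ n])
        (auto simp: diagonal_mat_def)
    then have "d0 * Determinant.det (1\<^sub>m n + kernel_mat u n t * diagonal_mat n s) =
        (\<Prod>i<n. 1 + l i * s i) * d s"
      unfolding d0_eq det_substochastic_mult .
    then have det: "Determinant.det (1\<^sub>m n + kernel_mat u n t * diagonal_mat n s) =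
        (\<Prod>i<n. 1 + l i * s i) * (d s / d0)"
      using d0 by (simp add: field_simps)
    have "(d s / d0) powr (- \<alpha>) = d0 powr \<alpha> * d s powr (- \<alpha>)"
      by (simp add: powr_divide powr_minus field_simps)
    then show "Determinant.det (1\<^sub>m n + kernel_mat u n t * diagonal_mat n s) powr (- \<alpha>) =
      (\<Prod>i<n. (1 + l i * s i) powr (- \<alpha>)) * f s"
      unfolding det f_def powr_mult prod_powr_distrib by simp
  qed
qed

text \<open>On the event each cutoff factor is at least \<open>1 - (1 / 2) ^ k\<close>. The expected
  product of these factors is at most that for independent gamma variables, where
  \<open>gamma_cutoff_upper\<close> and \<open>1 - z \<le> exp (- z)\<close> bound every
  factor.\<close>

lemma permanental_max_cdf_bound_step:
  assumes perm: "permanental_process \<alpha> u M Y" and \<alpha>: "0 < \<alpha>" and x: "0 < x"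
  shows "measure M {\<omega>\<in>space M. \<forall>i<n. Y (t i) \<omega> \<le> x} * (1 - (1 / 2) ^ k) ^ n \<le>
    exp (- ((1 - (1 / 2) ^ k) * (\<Sum>i<n. exp (- 2 * (1 + 2 * x / l i)) / (2 * Gamma \<alpha>))))"
proof -
  interpret prob_space M using perm by (simp add: permanental_process_def)
  have Y_meas [measurable]: "Y v \<in> borel_measurable M" for v
    using perm by (simp add: permanental_process_def)
  have Y_nn: "0 \<le> Y v \<omega>" if "\<omega> \<in> space M" for v \<omega>
    using perm that by (simp add: permanental_process_def)
  \<comment> \<open>With \<open>exp (- \<theta> * x) = 1 / 4 ^ k\<close> and \<open>N = 8 ^ k\<close>, the increasing function
    \<open>1 - (1 - exp (- \<theta> * y)) ^ N\<close> of \<open>exp (- \<theta> * y)\<close> tends to \<open>1\<close> for \<open>y \<le> x\<close> and to \<open>0\<close> for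
    \<open>y \<ge> 2 * x\<close> as \<open>k\<close> tends to infinity.\<close>
  define \<theta> where "\<theta> = real k * ln 4 / x"
  define K where "K = 8 ^ k - (1 :: nat)"
  define N where "N = Suc K"
  have N8: "real N = 8 ^ k" by (simp add: N_def K_def)
  define c where "c = cutoff_coeff N"
  have \<theta>: "0 \<le> \<theta>" using x by (simp add: \<theta>_def)
  have p: "0 \<le> (\<Sum>m\<le>N. c m * y ^ m)" if "0 \<le> y" "y \<le> 1" for y
    unfolding c_def sum_cutoff_coeff using that power_le_one[of "1 - y" N] by simp
  have p': "0 \<le> (\<Sum>m\<le>N. real m * c m * y ^ m)" if "0 \<le> y" "y \<le> 1" for y
    unfolding c_def N_def sum_cutoff_coeff_deriv using that by simp
  have nn: "\<And>i. i < n \<Longrightarrow> 0 \<le> l i" using l_pos by (simp add: less_imp_le)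
  obtain f where f: "f \<in> gamma_mixtures n l" "f (\<lambda>_. 0) = 1"
    "\<And>s. (\<forall>i<n. 0 \<le> s i) \<Longrightarrow>
      Determinant.det (1\<^sub>m n + kernel_mat u n t * diagonal_mat n s) powr (- \<alpha>) =
      (\<Prod>i<n. (1 + l i * s i) powr (- \<alpha>)) * f s"
    using det_powr_gamma_mixture[OF \<alpha>] by blast
  define \<phi> where "\<phi> s = (\<integral>\<omega>. (\<Prod>i<n. exp (- (s i * Y (t i) \<omega>))) \<partial>M)" for s
  have \<phi>: "\<phi> s = (\<Prod>i<n. (1 + l i * s i) powr (- \<alpha>)) * f s" if s: "\<forall>i<n. 0 \<le> s i" for s
  proof -
    have "(\<integral>\<omega>. exp (- (\<Sum>i<n. s i * Y (t i) \<omega>)) \<partial>M) =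
        Determinant.det (1\<^sub>m n + kernel_mat u n t * diagonal_mat n s) powr (- \<alpha>)"
      using perm s unfolding permanental_process_def by blast
    then show ?thesis unfolding f(3)[OF s, symmetric] \<phi>_def
      by (simp add: exp_sum sum_negf[symmetric])
  qed
  have int: "integrable M (\<lambda>\<omega>. \<Prod>i<n. exp (- (s i * Y (t i) \<omega>)))" if s: "\<forall>i<n. 0 \<le> s i" for s
  proof (rule integrable_const_bound[of _ 1])
    show "AE \<omega> in M. norm (\<Prod>i<n. exp (- (s i * Y (t i) \<omega>))) \<le> 1"
      using AE_space
    proof eventually_elim
      case (elim \<omega>)
      have "(\<Prod>i<n. exp (- (s i * Y (t i) \<omega>))) \<le> 1"
        using s Y_nn[OF elim] by (intro prod_le_1) auto
      moreover have "0 \<le> (\<Prod>i<n. exp (- (s i * Y (t i) \<omega>)))" by (intro prod_nonneg) auto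
      ultimately show ?case by simp
    qed
  qed measurable
  have s_nn: "\<forall>i<n. 0 \<le> \<theta> * real (m i)" for m :: "nat \<Rightarrow> nat" using \<theta> by simp
  have prod_eq: "(\<Prod>i<n. \<Sum>m\<le>N. c m * exp (- \<theta> * Y (t i) \<omega>) ^ m) =
      laplace_eval n N c \<theta> (\<lambda>s. \<Prod>i<n. exp (- (s i * Y (t i) \<omega>)))" for \<omega>
    by (subst laplace_eval_prod[where h="\<lambda>i v. exp (- (v * Y (t i) \<omega>))"])
      (simp add: exp_of_nat_mult[symmetric] algebra_simps)
  have int': "integrable M (\<lambda>\<omega>. \<Prod>i<n. \<Sum>m\<le>N. c m * exp (- \<theta> * Y (t i) \<omega>) ^ m)"
    unfolding prod_eq laplace_eval_def 
    by (intro Bochner_Integration.integrable_sum integrable_mult_right int s_nn)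
  have "(\<integral>\<omega>. (\<Prod>i<n. \<Sum>m\<le>N. c m * exp (- \<theta> * Y (t i) \<omega>) ^ m) \<partial>M) = laplace_eval n N c \<theta> \<phi>"
    unfolding prod_eq laplace_eval_def \<phi>_def using s_nn int
    by (subst Bochner_Integration.integral_sum) (auto intro!: integrable_mult_right)
  also have "\<dots> = laplace_eval n N c \<theta> (\<lambda>s. (\<Prod>i<n. (1 + l i * s i) powr (- \<alpha>)) * f s)"
    unfolding laplace_eval_def by (intro sum.cong refl arg_cong2[where f="(*)"] \<phi> s_nn)
  also have "\<dots> \<le> 1 * (\<Prod>i<n. \<Sum>m\<le>N. c m * (1 + l i * \<theta> * real m) powr (- \<alpha>))"
    using laplace_eval_gamma_mixture_le[OF f(1) nn \<alpha> \<theta> p p'] by (simp add: f(2))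
  also have "\<dots> \<le> (\<Prod>i<n. exp (- ((1 - (1 / 2) ^ k) * (exp (- 2 * (1 + 2 * x / l i)) / (2 * Gamma \<alpha>)))))"
    unfolding mult_1
  proof (intro prod_mono conjI)
    fix i assume "i \<in> {..<n}"
    then have i: "0 < l i" using l_pos by simp
    define y where "y = 1 + 2 * x / l i"
    define g where "g = exp (- 2 * y) / (2 * Gamma \<alpha>)"
    have g: "0 \<le> g" using \<alpha> by (simp add: g_def)
    have y: "1 \<le> y" using x i by (simp add: y_def)
    show "0 \<le> (\<Sum>m\<le>N. c m * (1 + l i * \<theta> * real m) powr (- \<alpha>))"
      using \<alpha> \<theta> i p by (intro gamma_poly_nonneg) auto
    have "(\<Sum>m\<le>N. c m * (1 + l i * \<theta> * real m) powr (- \<alpha>)) \<le> 1 - (1 - exp (- (l i * \<theta>) * y)) ^ N * g"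
      unfolding c_def g_def using \<alpha> \<theta> i y by (intro gamma_cutoff_upper) auto
    also have "\<dots> \<le> 1 - (1 - (1 / 2) ^ k) * g"
    proof -
      \<comment> \<open>Since \<open>l i * y\<close> exceeds \<open>2 * x\<close>, the exponential
        is at most \<open>(1 / 16) ^ k\<close>; Bernoulli's inequality with \<open>N = 8 ^ k\<close>
        then leaves \<open>1 - (8 / 16) ^ k\<close>.\<close>
      have "\<theta> * (2 * x) \<le> \<theta> * (l i * y)"
        using i x \<theta> by (intro mult_left_mono) (auto simp: y_def field_simps)
      moreover have "\<theta> * (2 * x) = real k * ln 16"
        using x ln_realpow[of 4 2] by (simp add: \<theta>_def)
      ultimately have "exp (- (l i * \<theta>) * y) \<le> exp (- (real k * ln 16))"
        by (simp add: algebra_simps)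
      also have "\<dots> = (1 / 16) ^ k"
        by (rule exp_minus_of_nat_mult_ln) simp
      finally have e: "exp (- (l i * \<theta>) * y) \<le> (1 / 16) ^ k" .
      have "1 - (1 / 2) ^ k = 1 + real N * (- ((1 / 16) ^ k))"
        by (simp add: N8 power_mult_distrib[symmetric])
      also have "\<dots> \<le> (1 + (- ((1 / 16) ^ k))) ^ N"
        by (rule Bernoulli_inequality) (simp add: power_le_one)
      also have "\<dots> \<le> (1 - exp (- (l i * \<theta>) * y)) ^ N"
        using e by (intro power_mono) (auto simp: power_le_one)
      finally show ?thesis using g by (simp add: mult_right_mono)
    qed
    also have "\<dots> \<le> exp (- ((1 - (1 / 2) ^ k) * g))"
      using exp_ge_add_one_self[of "- ((1 - (1 / 2) ^ k) * g)"] by simp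
    finally show "(\<Sum>m\<le>N. c m * (1 + l i * \<theta> * real m) powr (- \<alpha>)) \<le>
        exp (- ((1 - (1 / 2) ^ k) * (exp (- 2 * (1 + 2 * x / l i)) / (2 * Gamma \<alpha>))))"
      by (simp add: g_def y_def)
  qed
  also have "\<dots> = exp (- ((1 - (1 / 2) ^ k) * (\<Sum>i<n. exp (- 2 * (1 + 2 * x / l i)) / (2 * Gamma \<alpha>))))"
    by (simp add: exp_sum[symmetric] sum_negf sum_distrib_left)
  finally have upper: "(\<integral>\<omega>. (\<Prod>i<n. \<Sum>m\<le>N. c m * exp (- \<theta> * Y (t i) \<omega>) ^ m) \<partial>M) \<le>
    exp (- ((1 - (1 / 2) ^ k) * (\<Sum>i<n. exp (- 2 * (1 + 2 * x / l i)) / (2 * Gamma \<alpha>))))" .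
  let ?G = "{\<omega>\<in>space M. \<forall>i<n. Y (t i) \<omega> \<le> x}"
  have G: "?G \<in> sets M" by measurable
  have "measure M ?G * (1 - (1 / 2) ^ k) ^ n = (\<integral>\<omega>. indicator ?G \<omega> * (1 - (1 / 2) ^ k) ^ n \<partial>M)"
    using G by simp
  also have "\<dots> \<le> (\<integral>\<omega>. (\<Prod>i<n. \<Sum>m\<le>N. c m * exp (- \<theta> * Y (t i) \<omega>) ^ m) \<partial>M)"
  proof (rule Bochner_Integration.integral_mono[OF _ int'])
    show "integrable M (\<lambda>\<omega>. indicator ?G \<omega> * (1 - (1 / 2) ^ k) ^ n :: real)"
      using G by (intro integrable_mult_left) (auto simp: less_top[symmetric])
    fix \<omega> assume \<omega>: "\<omega> \<in> space M"
    have e: "0 \<le> exp (- \<theta> * Y (t i) \<omega>) \<and> exp (- \<theta> * Y (t i) \<omega>) \<le> 1" for i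
      using \<theta> Y_nn[OF \<omega>] by simp
    show "indicator ?G \<omega> * (1 - (1 / 2) ^ k) ^ n \<le> (\<Prod>i<n. \<Sum>m\<le>N. c m * exp (- \<theta> * Y (t i) \<omega>) ^ m)"
    proof (cases "\<omega> \<in> ?G")
      case False
      then show ?thesis using p e by (auto intro!: prod_nonneg)
    next
      case True
      have "(\<Prod>i<n. 1 - (1 / 2 :: real) ^ k) \<le> (\<Prod>i<n. \<Sum>m\<le>N. c m * exp (- \<theta> * Y (t i) \<omega>) ^ m)"
      proof (intro prod_mono conjI)
        fix i assume "i \<in> {..<n}"
        then have "Y (t i) \<omega> \<le> x" using True by simp
        \<comment> \<open>The complement of the cutoff is at most
          \<open>(1 - (1 / 4) ^ k) ^ N\<close>, and \<open>N = 8 ^ k\<close> makes this at most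
          \<open>exp (- (2 ^ k))\<close>.\<close>
        then have "\<theta> * Y (t i) \<omega> \<le> \<theta> * x" using \<theta> by (rule mult_left_mono)
        also have "\<theta> * x = real k * ln 4" using x by (simp add: \<theta>_def)
        finally have "exp (- (real k * ln 4)) \<le> exp (- \<theta> * Y (t i) \<omega>)" by simp
        moreover have "exp (- (real k * ln 4)) = (1 / 4 :: real) ^ k"
          by (rule exp_minus_of_nat_mult_ln) simp
        ultimately have "1 - exp (- \<theta> * Y (t i) \<omega>) \<le> 1 + - ((1 / 4) ^ k)" by simp
        also have "\<dots> \<le> exp (- ((1 / 4) ^ k))" by (rule exp_ge_add_one_self)
        finally have "(1 - exp (- \<theta> * Y (t i) \<omega>)) ^ N \<le> exp (- ((1 / 4) ^ k)) ^ N"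
          using e by (intro power_mono) auto
        also have "\<dots> = exp (- (2 ^ k))"
          by (simp add: exp_of_nat_mult[symmetric] N8 power_mult_distrib[symmetric])
        also have "\<dots> \<le> (1 / 2) ^ k"
        proof -
          have "(2::real) ^ k \<le> exp (2 ^ k)" using exp_ge_add_one_self[of "2 ^ k"] by linarith
          then have "inverse (exp (2 ^ k)) \<le> inverse ((2::real) ^ k)" by (intro le_imp_inverse_le) auto
          then show ?thesis by (simp only: exp_minus power_one_over inverse_eq_divide)
        qed
        finally show "1 - (1 / 2) ^ k \<le> (\<Sum>m\<le>N. c m * exp (- \<theta> * Y (t i) \<omega>) ^ m)"
          unfolding c_def sum_cutoff_coeff by simp
        show "0 \<le> 1 - (1 / 2 :: real) ^ k" by (simp add: power_le_one)
      qed
      then show ?thesis using True by simp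
    qed
  qed
  also note upper
  finally show ?thesis .
qed

lemma permanental_max_cdf_bound:
  assumes "permanental_process \<alpha> u M Y" "0 < \<alpha>" "0 < x"
  shows "measure M {\<omega>\<in>space M. \<forall>i<n. Y (t i) \<omega> \<le> x} \<le>
    exp (- (\<Sum>i<n. exp (- 2 * (1 + 2 * x / l i)) / (2 * Gamma \<alpha>)))"
proof -
  have z: "(\<lambda>k. (1 / 2 :: real) ^ k) \<longlonglongrightarrow> 0" by (rule LIMSEQ_realpow_zero) auto
  have "measure M {\<omega>\<in>space M. \<forall>i<n. Y (t i) \<omega> \<le> x} * (1 - 0) ^ n \<le>
      exp (- ((1 - 0) * (\<Sum>i<n. exp (- 2 * (1 + 2 * x / l i)) / (2 * Gamma \<alpha>))))"
  proof (rule LIMSEQ_le)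
    show "\<exists>k0. \<forall>k\<ge>k0. measure M {\<omega>\<in>space M. \<forall>i<n. Y (t i) \<omega> \<le> x} * (1 - (1 / 2) ^ k) ^ n \<le>
      exp (- ((1 - (1 / 2) ^ k) * (\<Sum>i<n. exp (- 2 * (1 + 2 * x / l i)) / (2 * Gamma \<alpha>))))"
      using permanental_max_cdf_bound_step[OF assms] by blast
  qed (intro tendsto_intros z)+
  then show ?thesis by simp
qed

end

text \<open>An analogue of Sudakov minoration: separation in \<open>sigma_sq\<close> bounds all
  scales \<open>l i\<close> from below by the common value \<open>a\<close>, which can replace them
  in \<open>permanental_max_cdf_bound\<close>.\<close>

lemma (in transient_markov_potential) permanental_max_cdf_sudakov:
  assumes perm: "permanental_process \<alpha> u M Y" and \<alpha>: "0 < \<alpha>" and x: "0 < x"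
    and C: "C < 1" and n: "2 \<le> n" and \<sigma>: "0 < \<sigma>"
    and diag: "\<And>s. \<bar>s\<bar> \<le> \<epsilon> \<Longrightarrow> u s s = u 0 0"
    and asym: "\<And>s t. \<bar>s\<bar> \<le> \<epsilon> \<Longrightarrow> \<bar>t\<bar> \<le> \<epsilon> \<Longrightarrow> \<bar>u s t - u t s\<bar> \<le> C * sigma_sq u s t"
    and t: "\<And>i. i < n \<Longrightarrow> \<bar>t i\<bar> \<le> \<epsilon>"
    and sep: "\<And>i j. i < n \<Longrightarrow> j < n \<Longrightarrow> i \<noteq> j \<Longrightarrow> \<sigma> \<le> sigma_sq u (t i) (t j)"
  shows "measure M {\<omega>\<in>space M. \<forall>i<n. Y (t i) \<omega> \<le> x} \<le>
    exp (- (real n * (exp (- 2 * (1 + 4 * x / ((1 - C) * \<sigma>))) / (2 * Gamma \<alpha>))))"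
proof -
  \<comment> \<open>Coinciding points would have \<open>sigma_sq\<close> 0, since \<open>u\<close>
    is constant on the diagonal there.\<close>
  have "inj_on t {..<n}"
  proof (rule inj_onI, rule ccontr)
    fix i j assume "i \<in> {..<n}" "j \<in> {..<n}" "t i = t j" "i \<noteq> j"
    then have "\<sigma> \<le> sigma_sq u (t i) (t i)" using sep[of i j] by simp
    also have "\<dots> = 0" using diag[OF t[of i]] \<open>i \<in> {..<n}\<close> by (simp add: sigma_sq_def)
    finally show False using \<sigma> by simp
  qed
  then obtain w l where l: "\<And>i. i < n \<Longrightarrow> 0 < l i" and w: "\<And>i j. i < n \<Longrightarrow> 0 \<le> w i j"
    and w_diag: "\<And>i. w i i = 0" and w_sum: "\<And>i. i < n \<Longrightarrow> (\<Sum>j<n. w i j) \<le> 1"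
    and dec: "\<And>i j. i < n \<Longrightarrow> j < n \<Longrightarrow>
      u (t i) (t j) = (if i = j then l i else 0) + (\<Sum>k<n. w i k * u (t k) (t j))"
    by (rule potential_matrix_decomposition) blast
  define a where "a = (1 - C) * \<sigma> / 2"
  have a: "0 < a" using C \<sigma> by (simp add: a_def)
  have gap: "a \<le> u 0 0 - u (t k) (t i)" if "i < n" "k < n" "k \<noteq> i" for i k
  proof -
    have "(1 - C) * \<sigma> \<le> (1 - C) * sigma_sq u (t k) (t i)"
      using C sep[OF that(2,1,3)] by (intro mult_left_mono) auto
    also have "\<dots> = sigma_sq u (t k) (t i) - C * sigma_sq u (t k) (t i)" by (simp add: algebra_simps)
    also have "\<dots> \<le> sigma_sq u (t k) (t i) - (u (t k) (t i) - u (t i) (t k))"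
      using asym[OF t[OF that(2)] t[OF that(1)]] by simp
    also have "\<dots> = 2 * (u 0 0 - u (t k) (t i))" by (simp add: sigma_sq_def)
    finally show ?thesis by (simp add: a_def)
  qed
  have l_ge: "a \<le> l i" if i: "i < n" for i
  proof -
    define S where "S = (\<Sum>k<n. w i k)"
    have "u 0 0 = l i + (\<Sum>k<n. w i k * u (t k) (t i))"
      using dec[OF i i] diag[OF t[OF i]] by simp
    also have "\<dots> \<le> l i + (\<Sum>k<n. w i k * (u 0 0 - a))"
    proof (intro add_left_mono sum_mono)
      fix k assume "k \<in> {..<n}"
      then show "w i k * u (t k) (t i) \<le> w i k * (u 0 0 - a)"
        using gap[OF i, of k] w[OF i, of k] w_diag[of i] by (cases "k = i") (auto intro: mult_left_mono)
    qed
    also have "\<dots> = l i + S * (u 0 0 - a)" by (simp add: S_def sum_distrib_right)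
    finally have 1: "u 0 0 - S * (u 0 0 - a) \<le> l i" by simp
    \<comment> \<open>A second index exists because \<open>2 \<le> n\<close>. Together with
      \<open>u_nonneg\<close> it gives \<open>0 \<le> u 0 0 - a\<close>, so that the row sum
      \<open>S\<close> can be replaced by its bound 1.\<close>
    obtain k where k: "k < n" "k \<noteq> i"
    proof (cases "i = 0")
      case True
      then show ?thesis using that[of 1] n by simp
    next
      case False
      then show ?thesis using that[of 0] n by simp
    qed
    have "0 \<le> u 0 0 - a" using gap[OF i k] u_nonneg[of "t k" "t i"] by simp
    then have "S * (u 0 0 - a) \<le> 1 * (u 0 0 - a)"
      using w_sum[OF i] by (intro mult_right_mono) (auto simp: S_def)
    then show ?thesis using 1 by simp
  qed
  have "measure M {\<omega>\<in>space M. \<forall>i<n. Y (t i) \<omega> \<le> x} \<le>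
      exp (- (\<Sum>i<n. exp (- 2 * (1 + 2 * x / l i)) / (2 * Gamma \<alpha>)))"
    by (rule permanental_max_cdf_bound[OF l w w_sum dec perm \<alpha> x])
  also have "\<dots> \<le> exp (- (\<Sum>i<n. exp (- 2 * (1 + 2 * x / a)) / (2 * Gamma \<alpha>)))"
  proof -
    have *: "exp (- 2 * (1 + 2 * x / a)) / (2 * Gamma \<alpha>) \<le> exp (- 2 * (1 + 2 * x / l i)) / (2 * Gamma \<alpha>)"
      if "i < n" for i
    proof -
      have "2 * x / l i \<le> 2 * x / a" using l_ge[OF that] a x by (intro divide_left_mono) auto
      then show ?thesis using \<alpha> by (intro divide_right_mono) auto
    qed
    show ?thesis
      unfolding exp_le_cancel_iff neg_le_iff_le by (intro sum_mono *) simp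
  qed
  also have "2 * x / a = 4 * x / ((1 - C) * \<sigma>)" by (simp add: a_def)
  finally show ?thesis by simp
qed

section \<open>From the limsup condition to unboundedness\<close>

lemma frequently_of_limsup_infinity:
  fixes f :: "nat \<Rightarrow> ereal"
  assumes "limsup f = \<infinity>"
  shows "\<exists>n\<ge>N. ereal B < f n"
proof (rule ccontr)
  assume "\<not> ?thesis"
  then have "\<forall>\<^sub>F n in sequentially. f n \<le> ereal B"
    by (auto simp: eventually_sequentially not_less)
  then have "limsup f \<le> ereal B" by (rule Limsup_bounded)
  then show False using assms by simp
qed

text \<open>The limsup condition supplies arbitrarily large \<open>n\<close> and \<open>n\<close>
  points with separation above \<open>B / ln n\<close>, for any prescribed \<open>B\<close>. For a
  suitable \<open>B\<close> the bound of \<open>permanental_max_cdf_sudakov\<close> is then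
  small.\<close>

lemma permanental_cdf_sup_zero:
  assumes pot: "transient_markov_potential \<Omega> F P X \<theta> L m u"
    and diag: "\<And>s. \<bar>s\<bar> \<le> \<epsilon> \<Longrightarrow> u s s = u 0 0"
    and C: "C < 1"
    and asym: "\<And>s t. \<bar>s\<bar> \<le> \<epsilon> \<Longrightarrow> \<bar>t\<bar> \<le> \<epsilon> \<Longrightarrow> \<bar>u s t - u t s\<bar> \<le> C * sigma_sq u s t"
    and limsup: "limsup (\<lambda>n. (SUP t\<in>{t. \<forall>i<n. \<bar>t i\<bar> \<le> \<epsilon>}. sigma_star_sq u n t) * ereal (ln (real n))) = \<infinity>"
    and \<alpha>: "0 < \<alpha>"
    and perm: "permanental_process \<alpha> u M Y"
    and x: "0 < x" and \<delta>: "0 < \<delta>"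
  shows "\<exists>(n :: nat) t. measure M {\<omega>\<in>space M. \<forall>i<n. Y (t i) \<omega> \<le> x} \<le> \<delta>"
proof -
  interpret transient_markov_potential \<Omega> F P X \<theta> L m u by (rule pot)
  define \<kappa> where "\<kappa> = exp (- 2) / (2 * Gamma \<alpha>)"
  have \<kappa>: "0 < \<kappa>" using \<alpha> by (simp add: \<kappa>_def)
  have "(\<lambda>n. exp (- (\<kappa> * sqrt (real n)))) \<longlonglongrightarrow> 0"
    using \<kappa> by real_asymp
  then have "\<forall>\<^sub>F n in sequentially. exp (- (\<kappa> * sqrt (real n))) < \<delta>"
    using \<delta> by (rule order_tendstoD)
  then obtain N where N: "\<And>n. N \<le> n \<Longrightarrow> exp (- (\<kappa> * sqrt (real n))) < \<delta>"
    by (auto simp: eventually_sequentially)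
  \<comment> \<open>With \<open>\<sigma> = B / ln n\<close> this makes
    \<open>4 * x / ((1 - C) * \<sigma>)\<close> equal to \<open>ln n / 4\<close>. After the factor
    \<open>- 2\<close> the exponential is of order \<open>1 / sqrt n\<close>, and \<open>n\<close>
    times it is of order \<open>sqrt n\<close>.\<close>
  define B where "B = 16 * x / (1 - C)"
  have B: "0 < B" using x C by (simp add: B_def)
  obtain n where n: "max N 2 \<le> n" and big:
    "ereal B < (SUP t\<in>{t. \<forall>i<n. \<bar>t i\<bar> \<le> \<epsilon>}. sigma_star_sq u n t) * ereal (ln (real n))"
    using frequently_of_limsup_infinity[OF limsup, of "max N 2" B] by blast
  define \<sigma> where "\<sigma> = B / ln (real n)"
  have ln: "0 < ln (real n)" using n by simp
  have \<sigma>: "0 < \<sigma>" using B ln by (simp add: \<sigma>_def)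
  have "ereal \<sigma> < (SUP t\<in>{t. \<forall>i<n. \<bar>t i\<bar> \<le> \<epsilon>}. sigma_star_sq u n t)"
  proof (rule ccontr)
    assume "\<not> ?thesis"
    then have "(SUP t\<in>{t. \<forall>i<n. \<bar>t i\<bar> \<le> \<epsilon>}. sigma_star_sq u n t) * ereal (ln (real n)) \<le>
        ereal \<sigma> * ereal (ln (real n))"
      using ln by (intro ereal_mult_right_mono) auto
    also have "\<dots> = ereal B" using ln by (simp add: \<sigma>_def)
    finally show False using big by simp
  qed
  then obtain t where t: "\<forall>i<n. \<bar>t i\<bar> \<le> \<epsilon>" "ereal \<sigma> < sigma_star_sq u n t"
    by (auto simp: less_SUP_iff)
  have sep: "\<sigma> \<le> sigma_sq u (t i) (t j)" if "i < n" "j < n" "i \<noteq> j" for i j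
  proof -
    have "sigma_star_sq u n t \<le> (\<lambda>(i, j). ereal (sigma_sq u (t i) (t j))) (i, j)"
      unfolding sigma_star_sq_def using that by (intro INF_lower) auto
    from less_le_trans[OF t(2) this] show ?thesis by simp
  qed
  have "measure M {\<omega>\<in>space M. \<forall>i<n. Y (t i) \<omega> \<le> x} \<le>
    exp (- (real n * (exp (- 2 * (1 + 4 * x / ((1 - C) * \<sigma>))) / (2 * Gamma \<alpha>))))"
    by (rule permanental_max_cdf_sudakov[OF perm \<alpha> x C _ \<sigma> diag asym _ sep]) (use n t in auto)
  also have "4 * x / ((1 - C) * \<sigma>) = ln (real n) / 4"
    using ln C x by (simp add: \<sigma>_def B_def field_simps)
  also have "real n * (exp (- 2 * (1 + ln (real n) / 4)) / (2 * Gamma \<alpha>)) = \<kappa> * sqrt (real n)"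
  proof -
    have "exp (- 2 * (1 + ln (real n) / 4)) = exp (- 2) * exp (- (ln (real n) / 2))"
      by (simp add: exp_add[symmetric] algebra_simps)
    also have "exp (- (ln (real n) / 2)) = 1 / sqrt (real n)"
    proof -
      have "ln (real n) / 2 = ln (sqrt (real n))" using n by (simp add: ln_sqrt)
      then show ?thesis using n by (simp add: exp_minus inverse_eq_divide)
    qed
    finally have "real n * (exp (- 2 * (1 + ln (real n) / 4)) / (2 * Gamma \<alpha>)) =
        \<kappa> * (real n / sqrt (real n))"
      by (simp add: \<kappa>_def mult_ac)
    then show ?thesis by (simp only: real_div_sqrt of_nat_0_le_iff)
  qed
  also have "exp (- (\<kappa> * sqrt (real n))) \<le> \<delta>" using N[of n] n by simp
  finally show ?thesis by blast
qed

theorem theorem1p4: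
  fixes \<Omega> :: "'a set" and F :: "ennreal \<Rightarrow> 'a measure" and P :: "real \<Rightarrow> 'a measure"
    and X :: "ennreal \<Rightarrow> 'a \<Rightarrow> ereal" and \<theta> :: "ennreal \<Rightarrow> 'a \<Rightarrow> 'a"
    and L :: "real \<Rightarrow> ennreal \<Rightarrow> 'a \<Rightarrow> ennreal" and m :: "real measure"
    and u :: "real \<Rightarrow> real \<Rightarrow> real" and \<epsilon> C \<alpha> :: real
    and M :: "'b measure" and Y :: "real \<Rightarrow> 'b \<Rightarrow> real"
  assumes "transient_markov_potential \<Omega> F P X \<theta> L m u"
    and "\<epsilon> > 0"
    and "\<And>s. \<bar>s\<bar> \<le> \<epsilon> \<Longrightarrow> u s s = u 0 0"
    and "C < 1"
    and "\<And>s t. \<bar>s\<bar> \<le> \<epsilon> \<Longrightarrow> \<bar>t\<bar> \<le> \<epsilon> \<Longrightarrow> \<bar>u s t - u t s\<bar> \<le> C * sigma_sq u s t"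
    and "limsup (\<lambda>n. (SUP t\<in>{t. \<forall>i<n. \<bar>t i\<bar> \<le> \<epsilon>}. sigma_star_sq u n t) * ereal (ln (real n))) = \<infinity>"
    and "\<alpha> > 0"
    and "permanental_process \<alpha> u M Y"
  shows "AE \<omega> in M. (SUP t. ereal (Y t \<omega>)) = \<infinity>"
proof -
  interpret prob_space M using assms(8) by (simp add: permanental_process_def)
  have [measurable]: "Y v \<in> borel_measurable M" for v
    using assms(8) by (simp add: permanental_process_def)
  have "AE \<omega> in M. \<not> (\<forall>t. Y t \<omega> \<le> real K)" for K :: nat
  proof -
    \<comment> \<open>The bound on \<open>Y t \<omega>\<close> for all \<open>t\<close> involves
      uncountably many times and need not define a measurable set; it is enclosed in
      finite-dimensional events of arbitrarily small probability.\<close>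
    have "\<exists>G. G \<in> events \<and> {\<omega>\<in>space M. \<forall>t. Y t \<omega> \<le> real K} \<subseteq> G \<and> prob G \<le> 1 / real (Suc j)" for j
    proof -
      \<comment> \<open>\<open>Suc K\<close> rather than \<open>K\<close>, because the threshold has
        to be positive.\<close>
      obtain n :: nat and t where
        "prob {\<omega>\<in>space M. \<forall>i<n. Y (t i) \<omega> \<le> real (Suc K)} \<le> 1 / real (Suc j)"
        using permanental_cdf_sup_zero[OF assms(1,3-8), of "real (Suc K)" "1 / real (Suc j)"] by auto
      moreover have "{\<omega>\<in>space M. \<forall>i<n. Y (t i) \<omega> \<le> real (Suc K)} \<in> events" by measurable
      moreover have "y \<le> real (Suc K)" if "y \<le> real K" for y using that by simp
      then have "{\<omega>\<in>space M. \<forall>t. Y t \<omega> \<le> real K} \<subseteq> {\<omega>\<in>space M. \<forall>i<n. Y (t i) \<omega> \<le> real (Suc K)}"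
        by blast
      ultimately show ?thesis by blast
    qed
    then have "\<forall>j. \<exists>G. G \<in> events \<and> {\<omega>\<in>space M. \<forall>t. Y t \<omega> \<le> real K} \<subseteq> G \<and>
        prob G \<le> 1 / real (Suc j)"
      by blast
    from choice[OF this] obtain G where "\<forall>j. G j \<in> events \<and>
        {\<omega>\<in>space M. \<forall>t. Y t \<omega> \<le> real K} \<subseteq> G j \<and> prob (G j) \<le> 1 / real (Suc j)" ..
    then have G: "G j \<in> events" "{\<omega>\<in>space M. \<forall>t. Y t \<omega> \<le> real K} \<subseteq> G j"
      "prob (G j) \<le> 1 / real (Suc j)" for j
      by blast+
    have "prob (\<Inter>j. G j) \<le> 1 / real (Suc j)" for j
      using finite_measure_mono[of "\<Inter>j. G j" "G j"] G(1)[of j] G(3)[of j] by (meson INT_lower UNIV_I order_trans)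
    moreover have "(\<lambda>j. 1 / real (Suc j)) \<longlonglongrightarrow> 0"
      by (rule LIMSEQ_Suc[OF lim_1_over_n])
    ultimately have "prob (\<Inter>j. G j) \<le> 0"
      by (intro LIMSEQ_le_const) auto
    then have "(\<Inter>j. G j) \<in> null_sets M"
      using G(1) by (intro null_setsI) (auto simp: emeasure_eq_measure measure_le_0_iff)
    then show ?thesis
      by (rule AE_I') (use G(2) in blast)
  qed
  then have "AE \<omega> in M. \<forall>K :: nat. \<not> (\<forall>t. Y t \<omega> \<le> real K)"
    by (simp add: AE_all_countable)
  then show ?thesis
  proof eventually_elim
    case (elim \<omega>)
    show ?case
    proof (rule SUP_PInfty)
      fix K :: nat
      obtain t where "real K < Y t \<omega>" using elim by (meson not_le)
      then show "\<exists>t\<in>UNIV. ereal (real K) \<le> ereal (Y t \<omega>)" by (auto intro: less_imp_le)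
    qed
  qed
qed

end
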